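(* Let $\mathbb{G}$ be a homogeneous group of homogeneous dimension $Q\ge3$, let $|\cdot|$ be a homogeneous quasi-norm on $\mathbb{G}$, and let $\mathcal{R}$ be the associated radial derivative operator. Then for every complex-valued function $f\in C_0^\infty(\mathbb{G}\setminus\{0\})$ and all $\alpha\in\mathbb{R}$, $$\left\|\frac{1}{|x|^{\alpha}}\mathcal{R}f\right\|_{L^2(\mathbb{G})}^2=\left(\frac{Q-2}{2}-\alpha\right)^2\left\|\frac{f}{|x|^{\alpha+1}}\right\|_{L^2(\mathbb{G})}^2+\left\|\frac{1}{|x|^{\alpha}}\mathcal{R}f+\frac{Q-2-2\alpha}{2|x|^{\alpha+1}}f\right\|_{L^2(\mathbb{G})}^2 .$$
   Context: A homogeneous group $\mathbb{G}$ is a connected, simply connected Lie group whose Lie algebra $\mathfrak{g}$ is equipped with a family of dilations $D_\lambda=\mathrm{Exp}(A\ln\lambda)=\sum_{k\ge0}\frac{1}{k!}(\ln(\lambda)A)^k$, $\lambda>0$, where $A$ is a diagonalisable linear operator on $\mathfrak{g}$ with positive eigenvalues and each $D_\lambda$ is a Lie algebra morphism. Such a group is nilpotent and the exponential map $\exp_{\mathbb{G}}:\mathfrak{g}\to\mathbb{G}$ is a global diffeomorphism; it transports the dilations to $\mathbb{G}$, where they are written $D_\lambda x$ or $\lambda x$, i.e. $D_\lambda(\exp_{\mathbb{G}}X)=\exp_{\mathbb{G}}(D_\lambda X)$. The homogeneous dimension is $Q=\mathrm{Tr}\,A$. The identity element of $\mathbb{G}$ is denoted $0$, $dx$ denotes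 Haar measure on $\mathbb{G}$, and $L^2(\mathbb{G})$ is taken with respect to $dx$. A homogeneous quasi-norm is a continuous function $|\cdot|:\mathbb{G}\to[0,\infty)$ with $|x^{-1}|=|x|$ for all $x\in\mathbb{G}$, $|\lambda x|=\lambda|x|$ for all $x\in\mathbb{G}$, $\lambda>0$, and $|x|=0$ if and only if $x=0$. The operator $\mathcal{R}=\frac{d}{d|x|}$ is the radial derivative: for $x\neq 0$, writing $x=D_{\rho}y$ with $\rho=|x|$ and $|y|=1$, $\mathcal{R}f(x)=\frac{d}{dr}f(D_r y)\big|_{r=\rho}$. $C_0^\infty(\mathbb{G}\setminus\{0\})$ is the space of smooth functions with compact support in $\mathbb{G}\setminus\{0\}$. *)

theory Defs
  imports "HOL-Analysis.Analysis"
begin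

text \<open>Groups are written additively, following the class \<open>topological_group_add\<close>, which is
  not assumed commutative: \<open>x + y\<close> is the group product, \<open>- x\<close> the inverse and \<open>0\<close> the
  identity.\<close>


subsection \<open>Smooth maps and Lie groups\<close>

text \<open>The following two notions are meant for open \<open>S\<close>; there, \<open>C\<^sup>k\<close> is expressed
  through iterated directional derivatives.\<close>

primrec Ck_on :: "nat \<Rightarrow> 'a::real_normed_vector set \<Rightarrow> ('a \<Rightarrow> 'b::real_normed_vector) \<Rightarrow> bool" where
  "Ck_on 0 S f \<longleftrightarrow> continuous_on S f"
| "Ck_on (Suc k) S f \<longleftrightarrow>
     (\<forall>x\<in>S. f differentiable (at x)) \<and> (\<forall>v. Ck_on k S (\<lambda>x. frechet_derivative f (at x) v))"

definition smooth_on :: "'a::real_normed_vector set \<Rightarrow> ('a \<Rightarrow> 'b::real_normed_vector) \<Rightarrow> bool" where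
  "smooth_on S f \<longleftrightarrow> open S \<and> (\<forall>k. Ck_on k S f)"

type_synonym ('g, 'm) atlas = "('g set \<times> ('g \<Rightarrow> 'm)) set"

definition smooth_atlas ::
  "('g::{t2_space, second_countable_topology}, 'm::euclidean_space) atlas \<Rightarrow> bool" where
  "smooth_atlas \<A> \<longleftrightarrow>
     (\<forall>(U, \<phi>)\<in>\<A>. open U \<and> open (\<phi> ` U) \<and> homeomorphism U (\<phi> ` U) \<phi> (inv_into U \<phi>)) \<and>
     (\<Union>(U, \<phi>)\<in>\<A>. U) = UNIV \<and>
     (\<forall>(U, \<phi>)\<in>\<A>. \<forall>(V, \<psi>)\<in>\<A>. smooth_on (\<phi> ` (U \<inter> V)) (\<psi> \<circ> inv_into U \<phi>))"

definition smooth_fun ::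
  "('g, 'm::euclidean_space) atlas \<Rightarrow> ('g \<Rightarrow> 'b::real_normed_vector) \<Rightarrow> bool" where
  "smooth_fun \<A> f \<longleftrightarrow> (\<forall>(U, \<phi>)\<in>\<A>. smooth_on (\<phi> ` U) (f \<circ> inv_into U \<phi>))"

definition lie_group ::
  "('g::{topological_group_add, t2_space, second_countable_topology}, 'm::euclidean_space) atlas
     \<Rightarrow> bool" where
  "lie_group \<A> \<longleftrightarrow>
     smooth_atlas \<A> \<and>
     (\<forall>(U, \<phi>)\<in>\<A>. \<forall>(V, \<psi>)\<in>\<A>. \<forall>(W, \<xi>)\<in>\<A>.
        smooth_on {(u, v). u \<in> \<phi> ` U \<and> v \<in> \<psi> ` V \<and> inv_into U \<phi> u + inv_into V \<psi> v \<in> W}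
          (\<lambda>(u, v). \<xi> (inv_into U \<phi> u + inv_into V \<psi> v))) \<and>
     (\<forall>(U, \<phi>)\<in>\<A>. \<forall>(V, \<psi>)\<in>\<A>.
        smooth_on {u. u \<in> \<phi> ` U \<and> - inv_into U \<phi> u \<in> V} (\<lambda>u. \<psi> (- inv_into U \<phi> u)))"


subsection \<open>Lie algebra and exponential map\<close>

text \<open>Left-invariant vector fields, as derivations of the algebra of real smooth functions.  The
  value outside that algebra is normalised to \<open>0\<close>, so that a vector field is represented by
  exactly one operator.\<close>

definition left_invariant_fields ::
  "('g::group_add, 'm::euclidean_space) atlas \<Rightarrow> (('g \<Rightarrow> real) \<Rightarrow> ('g \<Rightarrow> real)) set" where
  "left_invariant_fields \<A> = {V.
     (\<forall>f. smooth_fun \<A> f \<longrightarrow> smooth_fun \<A> (V f)) \<and>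
     (\<forall>f. \<not> smooth_fun \<A> f \<longrightarrow> V f = (\<lambda>_. 0)) \<and>
     (\<forall>f h a b. smooth_fun \<A> f \<and> smooth_fun \<A> h \<longrightarrow>
        V (\<lambda>x. a * f x + b * h x) = (\<lambda>x. a * V f x + b * V h x)) \<and>
     (\<forall>f h. smooth_fun \<A> f \<and> smooth_fun \<A> h \<longrightarrow>
        V (\<lambda>x. f x * h x) = (\<lambda>x. V f x * h x + f x * V h x)) \<and>
     (\<forall>f g. smooth_fun \<A> f \<longrightarrow> V (\<lambda>x. f (g + x)) = (\<lambda>x. V f (g + x)))}"

text \<open>The Lie algebra is a finite-dimensional real vector space \<open>'a\<close> together with a linear
  isomorphism \<open>L\<close> onto the left-invariant vector fields.  The inner product carried by
  the type \<open>'a\<close> is auxiliary and not related to the group.\<close>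

definition is_lie_algebra ::
  "('g::group_add, 'm::euclidean_space) atlas
     \<Rightarrow> ('a::euclidean_space \<Rightarrow> ('g \<Rightarrow> real) \<Rightarrow> ('g \<Rightarrow> real)) \<Rightarrow> bool" where
  "is_lie_algebra \<A> L \<longleftrightarrow>
     bij_betw L UNIV (left_invariant_fields \<A>) \<and>
     (\<forall>X Y a b f x. L (a *\<^sub>R X + b *\<^sub>R Y) f x = a * L X f x + b * L Y f x)"

definition lie_bracket ::
  "('a \<Rightarrow> ('g \<Rightarrow> real) \<Rightarrow> ('g \<Rightarrow> real)) \<Rightarrow> 'a \<Rightarrow> 'a \<Rightarrow> 'a" where
  "lie_bracket L X Y = inv L (\<lambda>f x. L X (L Y f) x - L Y (L X f) x)"

text \<open>\<open>t \<mapsto> lexp (t X)\<close> is the one-parameter subgroup with initial velocity \<open>X\<close>.\<close>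

definition is_exponential ::
  "('g::group_add, 'm::euclidean_space) atlas
     \<Rightarrow> ('a::euclidean_space \<Rightarrow> ('g \<Rightarrow> real) \<Rightarrow> ('g \<Rightarrow> real)) \<Rightarrow> ('a \<Rightarrow> 'g) \<Rightarrow> bool" where
  "is_exponential \<A> L lexp \<longleftrightarrow>
     (\<forall>X s t. lexp ((s + t) *\<^sub>R X) = lexp (s *\<^sub>R X) + lexp (t *\<^sub>R X)) \<and>
     (\<forall>X f. smooth_fun \<A> f \<longrightarrow>
        ((\<lambda>t. f (lexp (t *\<^sub>R X))) has_real_derivative L X f 0) (at 0))"

definition global_diffeo ::
  "('g, 'm::euclidean_space) atlas \<Rightarrow> ('a::euclidean_space \<Rightarrow> 'g) \<Rightarrow> bool" where
  "global_diffeo \<A> e \<longleftrightarrow>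
     bij e \<and>
     (\<forall>(U, \<phi>)\<in>\<A>. smooth_on (e -` U) (\<phi> \<circ> e) \<and> smooth_on (\<phi> ` U) (inv e \<circ> inv_into U \<phi>))"


subsection \<open>Homogeneous groups\<close>

definition diagonalisable :: "('a::euclidean_space \<Rightarrow> 'a) \<Rightarrow> bool" where
  "diagonalisable A \<longleftrightarrow>
     linear A \<and> (\<exists>B. independent B \<and> span B = UNIV \<and> (\<forall>b\<in>B. \<exists>c. A b = c *\<^sub>R b))"

definition lin_trace :: "('a::euclidean_space \<Rightarrow> 'a) \<Rightarrow> real" where
  "lin_trace A = (\<Sum>b\<in>Basis. A b \<bullet> b)"

text \<open>\<open>Exp (A ln r)\<close>, as its power series applied to \<open>X\<close>.\<close>

definition alg_dilation :: "('a::euclidean_space \<Rightarrow> 'a) \<Rightarrow> real \<Rightarrow> 'a \<Rightarrow> 'a" where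
  "alg_dilation A r X = (\<Sum>k. (1 / fact k) *\<^sub>R ((\<lambda>Y. ln r *\<^sub>R A Y) ^^ k) X)"

definition dilation ::
  "('a::euclidean_space \<Rightarrow> 'g) \<Rightarrow> ('a \<Rightarrow> 'a) \<Rightarrow> real \<Rightarrow> 'g \<Rightarrow> 'g" where
  "dilation lexp A r x = lexp (alg_dilation A r (inv lexp x))"

text \<open>A homogeneous group, with Lie algebra \<open>L\<close>, exponential map \<open>lexp\<close> and dilations generated
  by \<open>A\<close>.  That the exponential map is a global diffeomorphism is, by classical Lie theory,
  a consequence of the other clauses (the group is nilpotent and simply connected); it is
  recorded as part of the structure because the dilations of the group are defined through it.\<close>

definition homogeneous_group ::
  "('g::{topological_group_add, t2_space, second_countable_topology}, 'm::euclidean_space) atlas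
     \<Rightarrow> ('a::euclidean_space \<Rightarrow> ('g \<Rightarrow> real) \<Rightarrow> ('g \<Rightarrow> real)) \<Rightarrow> ('a \<Rightarrow> 'g) \<Rightarrow> ('a \<Rightarrow> 'a) \<Rightarrow> bool"
  where
  "homogeneous_group \<A> L lexp A \<longleftrightarrow>
     lie_group \<A> \<and>
     connected (UNIV :: 'g set) \<and>
     simply_connected (UNIV :: 'g set) \<and>
     is_lie_algebra \<A> L \<and>
     is_exponential \<A> L lexp \<and>
     global_diffeo \<A> lexp \<and>
     diagonalisable A \<and>
     (\<forall>c X. X \<noteq> 0 \<and> A X = c *\<^sub>R X \<longrightarrow> c > 0) \<and>
     (\<forall>r>0. linear (alg_dilation A r) \<and>
        (\<forall>X Y. alg_dilation A r (lie_bracket L X Y)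
                = lie_bracket L (alg_dilation A r X) (alg_dilation A r Y)))"

definition homogeneous_quasi_norm ::
  "('a::euclidean_space \<Rightarrow> 'g::{topological_space, group_add}) \<Rightarrow> ('a \<Rightarrow> 'a) \<Rightarrow> ('g \<Rightarrow> real) \<Rightarrow> bool"
  where
  "homogeneous_quasi_norm lexp A N \<longleftrightarrow>
     continuous_on UNIV N \<and>
     (\<forall>x. N x \<ge> 0) \<and>
     (\<forall>x. N (- x) = N x) \<and>
     (\<forall>x. \<forall>r>0. N (dilation lexp A r x) = r * N x) \<and>
     (\<forall>x. N x = 0 \<longleftrightarrow> x = 0)"

text \<open>For \<open>x \<noteq> 0\<close>, the point \<open>y\<close> with \<open>N y = 1\<close> and \<open>x = dilation (N x) y\<close> is
  \<open>dilation (1 / N x) x\<close>.\<close>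

definition radial_deriv ::
  "('a::euclidean_space \<Rightarrow> 'g) \<Rightarrow> ('a \<Rightarrow> 'a) \<Rightarrow> ('g \<Rightarrow> real) \<Rightarrow> ('g \<Rightarrow> complex) \<Rightarrow> 'g \<Rightarrow> complex" where
  "radial_deriv lexp A N f x =
     vector_derivative (\<lambda>r. f (dilation lexp A r (dilation lexp A (1 / N x) x))) (at (N x))"


subsection \<open>Haar measure, function spaces\<close>

text \<open>Regularity is automatic on a second countable locally compact Hausdorff group; homogeneous
  groups are unimodular, so a left Haar measure is also a right one.\<close>

definition haar_measure ::
  "'g::topological_group_add measure \<Rightarrow> bool" where
  "haar_measure \<mu> \<longleftrightarrow>
     sets \<mu> = sets borel \<and>
     (\<forall>g. distr \<mu> borel (\<lambda>x. g + x) = \<mu>) \<and>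
     (\<forall>K. compact K \<longrightarrow> emeasure \<mu> K < \<infinity>) \<and>
     (\<forall>U. open U \<and> U \<noteq> {} \<longrightarrow> emeasure \<mu> U > 0)"

definition in_L2 :: "'g measure \<Rightarrow> ('g \<Rightarrow> complex) \<Rightarrow> bool" where
  "in_L2 \<mu> h \<longleftrightarrow> h \<in> borel_measurable \<mu> \<and> integrable \<mu> (\<lambda>x. (cmod (h x))\<^sup>2)"

definition L2_norm :: "'g measure \<Rightarrow> ('g \<Rightarrow> complex) \<Rightarrow> real" where
  "L2_norm \<mu> h = sqrt (\<integral>x. (cmod (h x))\<^sup>2 \<partial>\<mu>)"

text \<open>\<open>C\<^sub>0\<^sup>\<infinity>\<close> of the group without the identity; its elements are extended by \<open>0\<close> to the group.\<close>

definition test_functions ::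
  "('g::{topological_space, group_add}, 'm::euclidean_space) atlas \<Rightarrow> ('g \<Rightarrow> complex) set" where
  "test_functions \<A> =
     {f. smooth_fun \<A> f \<and> compact (closure {x. f x \<noteq> 0}) \<and> 0 \<notin> closure {x. f x \<noteq> 0}}"

end

theory Submission
  imports Defs
begin

text \<open>
  Expanding the square of the last norm, the identity is equivalent to
  \<open>\<integral> N\<^sup>s E|f|\<^sup>2 = - (s + Q) \<integral> N\<^sup>s |f|\<^sup>2\<close> with \<open>s = - 2 \<alpha> - 2\<close> and the Euler field
  \<open>E = N d/dN\<close>.  This follows by differentiating at \<open>r = 1\<close> the integral of
  \<open>N\<^sup>s |f|\<^sup>2\<close> composed with the dilation by \<open>r\<close>, once Haar measure is known to scale by \<open>r\<^sup>Q\<close>.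

  For the scaling, Haar measure is identified with a multiple of Lebesgue measure in exponential
  coordinates.  There the left translation by \<open>g\<close> has derivative \<open>M (g p) S p\<close> at \<open>p\<close>, where
  the columns of \<open>M p\<close> are the left-invariant fields and \<open>S p\<close> is the inverse of \<open>M p\<close>.  Along
  rays, \<open>t S (t X)\<close> solves a linear differential equation whose coefficients involve only the Lie
  bracket, so a dilation, being a Lie algebra morphism, conjugates \<open>S\<close> at a point to \<open>S\<close> at the
  dilated point.  Hence \<open>det S\<close> is constant along dilation orbits, and letting \<open>r\<close> tend to
  \<open>0\<close> it equals \<open>1\<close>: Lebesgue measure is left-invariant.  It is also invariant under the
  inversion \<open>p \<mapsto> - p\<close>, which makes Haar measure unique up to a factor by Tonelli's theorem.
\<close>

section \<open>Calculus of smooth maps\<close>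

lemma Ck_on_cong:
  assumes "open S" "\<And>x. x \<in> S \<Longrightarrow> f x = g x" "Ck_on k S f"
  shows "Ck_on k S g"
  using assms(2,3)
proof (induction k arbitrary: f g)
  case 0
  then show ?case by (simp add: continuous_on_eq)
next
  case (Suc k)
  have f: "f differentiable (at x)" if "x \<in> S" for x
    using Suc.prems(2) that by simp
  have "frechet_derivative f (at x) = frechet_derivative g (at x)" if "x \<in> S" for x
    by (rule frechet_derivative_transform_within_open[OF f assms(1)]) (use that Suc.prems in auto)
  moreover have "g differentiable (at x)" if "x \<in> S" for x
    using has_derivative_transform_within_open[OF _ assms(1) that] f[OF that] Suc.prems(1)
    by (meson differentiable_def)
  ultimately show ?case
    using Suc.IH[of "\<lambda>x. frechet_derivative f (at x) _" "\<lambda>x. frechet_derivative g (at x) _"]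
      Suc.prems by auto
qed

lemma Ck_on_local:
  assumes "\<And>x. x \<in> S \<Longrightarrow> \<exists>T. open T \<and> x \<in> T \<and> Ck_on k T f"
  shows "Ck_on k S f"
  using assms
proof (induction k arbitrary: f)
  case 0
  have "continuous (at x) f" if "x \<in> S" for x
    using 0[OF that] continuous_on_eq_continuous_at by auto
  then show ?case by (simp add: continuous_at_imp_continuous_on)
next
  case (Suc k)
  have "f differentiable (at x)" if "x \<in> S" for x
    using Suc.prems[OF that] by auto
  moreover have "Ck_on k S (\<lambda>x. frechet_derivative f (at x) v)" for v
    by (rule Suc.IH) (use Suc.prems in fastforce)
  ultimately show ?case by auto
qed

lemma Ck_on_SucD: "Ck_on (Suc k) S f \<Longrightarrow> Ck_on k S f"
proof (induction k arbitrary: f)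
  case 0
  then have "continuous (at x) f" if "x \<in> S" for x
    using that differentiable_imp_continuous_within by auto
  then show ?case by (simp add: continuous_at_imp_continuous_on)
next
  case (Suc k)
  then show ?case by (metis Ck_on.simps(2))
qed

lemma Ck_on_const: "Ck_on k S (\<lambda>x. c)"
  by (induction k arbitrary: c) auto

lemma Ck_on_bounded_linear: "bounded_linear f \<Longrightarrow> Ck_on k S f"
proof (induction k)
  case 0
  then show ?case by (simp add: linear_continuous_on)
next
  case (Suc k)
  then have "frechet_derivative f (at x) = f" for x
    by (metis bounded_linear_imp_has_derivative frechet_derivative_at)
  with Suc show ?case
    by (simp add: bounded_linear_imp_differentiable Ck_on_const)
qed

lemma Ck_on_add:
  assumes "open S" "Ck_on k S f" "Ck_on k S g"
  shows "Ck_on k S (\<lambda>x. f x + g x)"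
  using assms(2,3)
proof (induction k arbitrary: f g)
  case 0
  then show ?case by (simp add: continuous_on_add)
next
  case (Suc k)
  have D: "((\<lambda>x. f x + g x) has_derivative (\<lambda>v. frechet_derivative f (at x) v
      + frechet_derivative g (at x) v)) (at x)" if "x \<in> S" for x
    using Suc.prems that by (intro has_derivative_add) (auto simp: frechet_derivative_works)
  have fd: "frechet_derivative (\<lambda>x. f x + g x) (at x) v
      = frechet_derivative f (at x) v + frechet_derivative g (at x) v" if "x \<in> S" for x v
    using frechet_derivative_at[OF D[OF that]] by metis
  have "Ck_on k S (\<lambda>x. frechet_derivative (\<lambda>x. f x + g x) (at x) v)" for v
    by (rule Ck_on_cong[OF assms(1) _ Suc.IH]) (use fd Suc.prems in auto)
  then show ?case using Suc.prems by auto
qed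

lemma Ck_on_sum:
  assumes "open S" "\<And>i. i \<in> I \<Longrightarrow> Ck_on k S (f i)"
  shows "Ck_on k S (\<lambda>x. \<Sum>i\<in>I. f i x)"
  using assms(2)
  by (induction I rule: infinite_finite_induct) (auto intro: Ck_on_const Ck_on_add[OF assms(1)])

text \<open>The Leibniz rule produces two terms, each pairing one factor with a derivative of the
  other. Hence the induction keeps both factors arbitrary and lowers the order of the
  undifferentiated one by \<open>Ck_on_SucD\<close>.\<close>

lemma Ck_on_bilinear:
  assumes "bounded_bilinear B" "open S" "Ck_on k S f" "Ck_on k S g"
  shows "Ck_on k S (\<lambda>x. B (f x) (g x))"
  using assms(3,4)
proof (induction k arbitrary: f g)
  case 0
  then show ?case by (simp add: bounded_bilinear.continuous_on[OF assms(1)])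
next
  case (Suc k)
  have D: "((\<lambda>x. B (f x) (g x)) has_derivative (\<lambda>v. B (f x) (frechet_derivative g (at x) v)
      + B (frechet_derivative f (at x) v) (g x))) (at x)" if "x \<in> S" for x
    using bounded_bilinear.FDERIV[OF assms(1), of f _ x UNIV g] Suc.prems that
    by (simp add: frechet_derivative_works)
  have fd: "frechet_derivative (\<lambda>x. B (f x) (g x)) (at x) v = B (f x) (frechet_derivative g (at x) v)
      + B (frechet_derivative f (at x) v) (g x)" if "x \<in> S" for x v
    using frechet_derivative_at[OF D[OF that]] by metis
  have "Ck_on k S (\<lambda>x. frechet_derivative (\<lambda>x. B (f x) (g x)) (at x) v)" for v
    by (rule Ck_on_cong[OF assms(2) _ Ck_on_add[OF assms(2)
          Suc.IH[of f "\<lambda>x. frechet_derivative g (at x) v"]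
          Suc.IH[of "\<lambda>x. frechet_derivative f (at x) v" g]]])
      (use fd Suc.prems Ck_on_SucD[OF Suc.prems(1)] Ck_on_SucD[OF Suc.prems(2)] in auto)
  then show ?case using D by (auto simp: differentiable_def)
qed

text \<open>Smoothness is phrased with derivatives in fixed directions. This expansion reduces a
  derivative applied to a vector that varies with the base point to finitely many such
  directions.\<close>

lemma linear_euclidean_expansion:
  fixes D :: "'a::euclidean_space \<Rightarrow> 'b::real_vector"
  assumes "linear D"
  shows "D v = (\<Sum>b\<in>Basis. (v \<bullet> b) *\<^sub>R D b)"
proof -
  have "D v = D (\<Sum>b\<in>Basis. (v \<bullet> b) *\<^sub>R b)" by (simp add: euclidean_representation)
  also have "\<dots> = (\<Sum>b\<in>Basis. (v \<bullet> b) *\<^sub>R D b)"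
    by (simp only: linear_sum[OF assms] linear_cmul[OF assms])
  finally show ?thesis .
qed

text \<open>The chain rule applies the derivative of \<open>g\<close> to the moving vector
  \<open>?f' x v\<close>. Expanding that vector in the basis of the Euclidean middle space leaves
  products of scalar functions with fixed-direction derivatives of \<open>g\<close>, to which the
  induction hypothesis applies.\<close>

lemma Ck_on_compose:
  fixes f :: "'a::real_normed_vector \<Rightarrow> 'b::euclidean_space"
    and g :: "'b \<Rightarrow> 'c::real_normed_vector"
  assumes "open S" "Ck_on k S f" "Ck_on k T g" "f ` S \<subseteq> T"
  shows "Ck_on k S (g \<circ> f)"
  using assms(2,3)
proof (induction k arbitrary: g)
  case 0
  then show ?case
    using assms(4) continuous_on_compose continuous_on_subset by (metis Ck_on.simps(1))
next
  case (Suc k)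
  let ?f' = "\<lambda>x. frechet_derivative f (at x)"
  let ?g' = "\<lambda>y. frechet_derivative g (at y)"
  have g: "g differentiable (at (f x))" and f: "f differentiable (at x)" if "x \<in> S" for x
    using Suc.prems assms(4) that by auto
  have fd: "frechet_derivative (g \<circ> f) (at x) = ?g' (f x) \<circ> ?f' x" if "x \<in> S" for x
    by (rule frechet_derivative_compose[OF f g]) (fact that)+
  have fd': "frechet_derivative (g \<circ> f) (at x) v = (\<Sum>b\<in>Basis. (?f' x v \<bullet> b) *\<^sub>R ?g' (f x) b)"
    if "x \<in> S" for x v
    unfolding fd[OF that] comp_apply[of "?g' (f x)"]
    by (rule linear_euclidean_expansion[OF linear_frechet_derivative[OF g[OF that]]])
  have inner: "Ck_on k S (\<lambda>x. ?f' x v \<bullet> b)" for v b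
    by (rule Ck_on_bilinear[OF bounded_bilinear_inner assms(1) _ Ck_on_const])
      (use Suc.prems(1) in simp)
  have comp: "Ck_on k S (\<lambda>x. ?g' (f x) b)" for b
    using Suc.IH[OF Ck_on_SucD[OF Suc.prems(1)], of "\<lambda>y. ?g' y b"] Suc.prems(2) by (simp add: o_def)
  have "Ck_on k S (\<lambda>x. frechet_derivative (g \<circ> f) (at x) v)" for v
    by (rule Ck_on_cong[OF assms(1) _ Ck_on_sum[OF assms(1)]])
      (use fd' Ck_on_bilinear[OF bounded_bilinear_scaleR assms(1) inner comp] in auto)
  then show ?case using f g differentiable_chain_at by (metis Ck_on.simps(2))
qed

lemma Ck_on_Pair:
  fixes f :: "'a::real_normed_vector \<Rightarrow> 'b::real_normed_vector"
    and g :: "'a \<Rightarrow> 'c::real_normed_vector"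
  assumes "open S" "Ck_on k S f" "Ck_on k S g"
  shows "Ck_on k S (\<lambda>x. (f x, g x))"
  using assms(2,3)
proof (induction k arbitrary: f g)
  case 0
  then show ?case by (simp add: continuous_on_Pair)
next
  case (Suc k)
  have D: "((\<lambda>x. (f x, g x)) has_derivative (\<lambda>v. (frechet_derivative f (at x) v,
      frechet_derivative g (at x) v))) (at x)" if "x \<in> S" for x
    using Suc.prems that by (intro has_derivative_Pair) (auto simp: frechet_derivative_works)
  have fd: "frechet_derivative (\<lambda>x. (f x, g x)) (at x) v
      = (frechet_derivative f (at x) v, frechet_derivative g (at x) v)" if "x \<in> S" for x v
    using frechet_derivative_at[OF D[OF that]] by metis
  have "Ck_on k S (\<lambda>x. frechet_derivative (\<lambda>x. (f x, g x)) (at x) v)" for v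
    by (rule Ck_on_cong[OF assms(1) _ Suc.IH]) (use fd Suc.prems in auto)
  then show ?case using D by (auto simp: differentiable_def)
qed

lemma smooth_on_cong:
  "smooth_on S f \<Longrightarrow> (\<And>x. x \<in> S \<Longrightarrow> f x = g x) \<Longrightarrow> smooth_on S g"
  using Ck_on_cong by (metis smooth_on_def)

lemma smooth_on_local:
  assumes "open S" "\<And>x. x \<in> S \<Longrightarrow> \<exists>T. x \<in> T \<and> smooth_on T f"
  shows "smooth_on S f"
  unfolding smooth_on_def using assms Ck_on_local by (metis smooth_on_def)

lemma smooth_on_compose:
  fixes f :: "'a::real_normed_vector \<Rightarrow> 'b::euclidean_space"
    and g :: "'b \<Rightarrow> 'c::real_normed_vector"
  assumes "smooth_on S f" "smooth_on T g" "f ` S \<subseteq> T"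
  shows "smooth_on S (g \<circ> f)"
  using assms Ck_on_compose unfolding smooth_on_def by blast

lemma smooth_on_bilinear:
  "bounded_bilinear B \<Longrightarrow> smooth_on S f \<Longrightarrow> smooth_on S g \<Longrightarrow> smooth_on S (\<lambda>x. B (f x) (g x))"
  unfolding smooth_on_def by (blast intro: Ck_on_bilinear)

lemma smooth_on_add: "smooth_on S f \<Longrightarrow> smooth_on S g \<Longrightarrow> smooth_on S (\<lambda>x. f x + g x)"
  unfolding smooth_on_def by (blast intro: Ck_on_add)

lemma smooth_on_Pair: "smooth_on S f \<Longrightarrow> smooth_on S g \<Longrightarrow> smooth_on S (\<lambda>x. (f x, g x))"
  unfolding smooth_on_def by (blast intro: Ck_on_Pair)

lemma smooth_on_const: "open S \<Longrightarrow> smooth_on S (\<lambda>x. c)"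
  by (simp add: smooth_on_def Ck_on_const)

lemma smooth_on_bounded_linear: "open S \<Longrightarrow> bounded_linear f \<Longrightarrow> smooth_on S f"
  by (simp add: smooth_on_def Ck_on_bounded_linear)

lemma smooth_on_imp_continuous_on: "smooth_on S f \<Longrightarrow> continuous_on S f"
  by (metis Ck_on.simps(1) smooth_on_def)

lemma smooth_on_imp_differentiable: "smooth_on S f \<Longrightarrow> x \<in> S \<Longrightarrow> f differentiable (at x)"
  by (metis Ck_on.simps(2) smooth_on_def)

lemma smooth_on_has_derivative:
  "smooth_on S f \<Longrightarrow> x \<in> S \<Longrightarrow> (f has_derivative frechet_derivative f (at x)) (at x)"
  using smooth_on_imp_differentiable frechet_derivative_works by blast

lemma smooth_on_frechet_derivative:
  "smooth_on S f \<Longrightarrow> smooth_on S (\<lambda>x. frechet_derivative f (at x) v)"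
  by (metis Ck_on.simps(2) smooth_on_def)

section \<open>Group laws in exponential coordinates\<close>

text \<open>This is the product rule for an operator acting on a vector when the operator is only
  known to be differentiable on each fixed vector. In finite dimension, differentiating the
  coordinates against the operator's values on a basis is enough.\<close>

lemma has_derivative_linear_family:
  fixes T :: "'b::real_normed_vector \<Rightarrow> 'a::euclidean_space \<Rightarrow> 'c::real_normed_vector"
  assumes "\<And>x. linear (T x)" and D: "\<And>Y. ((\<lambda>x. T x Y) has_derivative D Y) (at p)"
    and w: "(w has_derivative w') (at p)"
  shows "((\<lambda>x. T x (w x)) has_derivative (\<lambda>v. D (w p) v + T p (w' v))) (at p)"
proof -
  have T: "T x Y = (\<Sum>b\<in>Basis. (Y \<bullet> b) *\<^sub>R T x b)" for x Y
    by (rule linear_euclidean_expansion[OF assms(1)])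
  \<comment> \<open>Linearity of \<open>D Y\<close> in \<open>Y\<close> is inherited from
    \<open>T x\<close> by uniqueness of derivatives.\<close>
  have D_sum: "D Y v = (\<Sum>b\<in>Basis. (Y \<bullet> b) *\<^sub>R D b v)" for Y v
  proof -
    have "((\<lambda>x. \<Sum>b\<in>Basis. (Y \<bullet> b) *\<^sub>R T x b) has_derivative (\<lambda>v. \<Sum>b\<in>Basis. (Y \<bullet> b) *\<^sub>R D b v)) (at p)"
      by (intro has_derivative_sum has_derivative_scaleR_right D)
    then have "((\<lambda>x. T x Y) has_derivative (\<lambda>v. \<Sum>b\<in>Basis. (Y \<bullet> b) *\<^sub>R D b v)) (at p)"
      by (simp only: T[of _ Y, symmetric])
    from fun_cong[OF has_derivative_unique[OF D this]] show ?thesis .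
  qed
  have "((\<lambda>x. \<Sum>b\<in>Basis. (w x \<bullet> b) *\<^sub>R T x b) has_derivative
      (\<lambda>v. \<Sum>b\<in>Basis. (w p \<bullet> b) *\<^sub>R D b v + (w' v \<bullet> b) *\<^sub>R T p b)) (at p)"
    by (intro has_derivative_sum has_derivative_scaleR D has_derivative_inner_left w)
  also have "(\<lambda>v. \<Sum>b\<in>Basis. (w p \<bullet> b) *\<^sub>R D b v + (w' v \<bullet> b) *\<^sub>R T p b)
      = (\<lambda>v. D (w p) v + T p (w' v))"
    by (rule ext) (simp only: sum.distrib D_sum[of "w p"] T[of p "w' _"])
  also have "(\<lambda>x. \<Sum>b\<in>Basis. (w x \<bullet> b) *\<^sub>R T x b) = (\<lambda>x. T x (w x))"
    by (rule ext, rule T[symmetric])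
  finally show ?thesis .
qed

text \<open>Gronwall: \<open>exp (- 2 K t) * |z|\<^sup>2\<close> is nonincreasing.\<close>

lemma linear_ode_zero:
  fixes z :: "real \<Rightarrow> 'a::euclidean_space"
  assumes "linear B" and "z 0 = 0"
    and z: "\<And>t. (z has_vector_derivative - B (z t)) (at t)" and "T \<ge> 0"
  shows "z T = 0"
proof -
  obtain K where K: "\<And>x. norm (B x) \<le> norm x * K"
    using assms(1) bounded_linear.bounded linear_conv_bounded_linear by metis
  define h where "h t = exp (- 2 * K * t) * (z t \<bullet> z t)" for t
  define h' where "h' t = exp (- 2 * K * t) * (- 2 * (B (z t) \<bullet> z t) - 2 * K * (z t \<bullet> z t))" for t
  have "(h has_real_derivative h' t) (at t)" for t
  proof -
    have zz: "((\<lambda>t. z t \<bullet> z t) has_real_derivative z t \<bullet> (- B (z t)) + (- B (z t)) \<bullet> z t) (at t)"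
      using has_derivative_inner[OF z[unfolded has_vector_derivative_def] z[unfolded has_vector_derivative_def]]
      unfolding has_field_derivative_def
      by (rule has_derivative_eq_rhs) (auto simp: algebra_simps)
    show ?thesis
      unfolding h_def h'_def
      by (rule derivative_eq_intros zz refl)+ (simp add: algebra_simps inner_commute)
  qed
  moreover have "h' t \<le> 0" for t
  proof -
    have "- (B (z t) \<bullet> z t) \<le> norm (B (z t)) * norm (z t)"
      using Cauchy_Schwarz_ineq2[of "B (z t)" "z t"] by linarith
    also have "\<dots> \<le> norm (z t) * K * norm (z t)"
      by (intro mult_right_mono K) auto
    also have "\<dots> = K * (z t \<bullet> z t)"
      by (simp add: dot_square_norm power2_eq_square)
    finally show ?thesis by (simp add: h'_def mult_nonneg_nonpos)
  qed
  ultimately have "h T \<le> h 0"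
    using DERIV_nonpos_imp_nonincreasing[OF \<open>T \<ge> 0\<close>] by blast
  then show ?thesis
    using assms(2) inner_ge_zero[of "z T"] by (simp add: h_def mult_le_0_iff del: inner_ge_zero)
qed

section \<open>The left-invariant frame of a group law on a vector space\<close>

definition partial2 ::
  "('a::real_normed_vector \<Rightarrow> 'b::real_normed_vector \<Rightarrow> 'c::real_normed_vector)
    \<Rightarrow> 'a \<Rightarrow> 'b \<Rightarrow> 'b \<Rightarrow> 'c" where
  "partial2 m p q v = frechet_derivative (\<lambda>z. m (fst z) (snd z)) (at (p, q)) (0, v)"

abbreviation left_frame where "left_frame m p \<equiv> partial2 m p 0"

text \<open>This is a group read through its exponential map. The condition \<open>ray\<close> says
  that straight lines through the origin are one-parameter subgroups, which forces the inverse of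
  \<open>p\<close> to be \<open>- p\<close>.\<close>

locale exp_coords =
  fixes m :: "'a::euclidean_space \<Rightarrow> 'a \<Rightarrow> 'a"
  assumes smooth_m: "smooth_on UNIV (\<lambda>z. m (fst z) (snd z))"
    and assoc: "m (m p q) r = m p (m q r)"
    and zero_left: "m 0 p = p"
    and ray: "m (s *\<^sub>R X) (t *\<^sub>R X) = (s + t) *\<^sub>R X"
begin

lemma minus_left: "m (- p) p = 0"
  using ray[of "-1" p 1] by simp

lemma minus_right: "m p (- p) = 0"
  using ray[of 1 p "-1"] by simp

lemma zero_right: "m p 0 = p"
  using ray[of 1 p 0] by simp

lemma has_derivative_m2: "((\<lambda>q. m p q) has_derivative partial2 m p q) (at q)"
proof -
  have "((\<lambda>z. m (fst z) (snd z)) \<circ> Pair p has_derivative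
      frechet_derivative (\<lambda>z. m (fst z) (snd z)) (at (p, q)) \<circ> Pair 0) (at q)"
    by (rule diff_chain_at) (auto intro!: derivative_eq_intros smooth_on_has_derivative[OF smooth_m])
  then show ?thesis by (simp add: o_def partial2_def[abs_def])
qed

lemma linear_partial2: "linear (partial2 m p q)"
  using has_derivative_linear[OF has_derivative_m2] .

lemma smooth_partial2:
  assumes "bounded_linear a" "bounded_linear b"
  shows "smooth_on UNIV (\<lambda>p. partial2 m (a p) (b p) v)"
proof -
  have "smooth_on UNIV (\<lambda>p. (a p, b p))"
    using assms by (intro smooth_on_Pair smooth_on_bounded_linear) auto
  from smooth_on_compose[OF this smooth_on_frechet_derivative[OF smooth_m, of "(0, v)"]]
  show ?thesis by (simp add: partial2_def o_def)
qed

abbreviation "M \<equiv> left_frame m"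
text \<open>This is the differential at \<open>p\<close> of left translation by the inverse of
  \<open>p\<close>, that is, the left Maurer-Cartan form.\<close>

definition "S p = partial2 m (- p) p"
definition "M' p Y v = frechet_derivative (\<lambda>p. M p Y) (at p) v"
definition "S' p Y v = frechet_derivative (\<lambda>p. S p Y) (at p) v"

lemma linear_S: "linear (S p)"
  by (simp add: S_def linear_partial2)

lemma smooth_M: "smooth_on UNIV (\<lambda>p. M p Y)"
  using smooth_partial2[of "\<lambda>x. x" "\<lambda>x. 0"] by simp

lemma smooth_S: "smooth_on UNIV (\<lambda>p. S p Y)"
  using smooth_partial2[of uminus "\<lambda>x. x"] by (simp add: S_def bounded_linear_minus)

lemma deriv_M: "((\<lambda>p. M p Y) has_derivative M' p Y) (at p)"
  using smooth_on_has_derivative[OF smooth_M] by (simp add: M'_def[abs_def])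

lemma deriv_S: "((\<lambda>p. S p Y) has_derivative S' p Y) (at p)"
  using smooth_on_has_derivative[OF smooth_S] by (simp add: S'_def[abs_def])

text \<open>Associativity says that translating by \<open>p\<close> and then by \<open>g\<close> is
  translating by \<open>m g p\<close>; the chain rule turns this into a cocycle identity. Its
  specialisations show that \<open>M p\<close> and \<open>S p\<close> are inverse to each other and
  that every differential of a translation factors through the identity.\<close>

lemma partial2_comp: "partial2 m g (m p q) (partial2 m p q v) = partial2 m (m g p) q v"
proof -
  have "(m g \<circ> m p has_derivative partial2 m g (m p q) \<circ> partial2 m p q) (at q)"
    by (rule diff_chain_at[OF has_derivative_m2 has_derivative_m2])
  moreover have "m g \<circ> m p = m (m g p)" by (auto simp: assoc)
  ultimately have "partial2 m g (m p q) \<circ> partial2 m p q = partial2 m (m g p) q"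
    using has_derivative_m2 has_derivative_unique by metis
  then show ?thesis by (metis comp_apply)
qed

lemma partial2_zero_left: "partial2 m 0 q v = v"
proof -
  have "(m 0 has_derivative (\<lambda>v. v)) (at q)"
    by (simp add: zero_left[abs_def])
  then show ?thesis using has_derivative_unique[OF has_derivative_m2] by metis
qed

lemma S_M: "S p (M p v) = v"
  using partial2_comp[of "- p" p 0 v] by (simp add: zero_right minus_left S_def partial2_zero_left)

lemma M_S: "M p (S p v) = v"
  using partial2_comp[of p "- p" p v] by (simp add: minus_left minus_right S_def partial2_zero_left)

lemma partial2_eq: "partial2 m g p v = M (m g p) (S p v)"
  using partial2_comp[of g p 0 "S p v"] by (simp add: zero_right M_S)

text \<open>The ray through \<open>p\<close> is an integral curve of the left-invariant field of
  \<open>p\<close>: starting from \<open>p\<close>, right multiplication by \<open>t p\<close> gives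
  \<open>(1 + t) p\<close>. Comparing velocities at \<open>t = 0\<close> identifies the field at
  \<open>p\<close> with the radial vector.\<close>

lemma M_self: "M p p = p"
proof -
  have "(m p \<circ> (\<lambda>t. t *\<^sub>R p) has_derivative M p \<circ> (\<lambda>t. t *\<^sub>R p)) (at (0::real))"
    by (rule diff_chain_at) (use has_derivative_m2[of p 0] in \<open>auto intro!: derivative_eq_intros\<close>)
  moreover have "m p \<circ> (\<lambda>t. t *\<^sub>R p) = (\<lambda>t. (1 + t) *\<^sub>R p)"
    using ray[of 1 p] by (auto simp: o_def)
  moreover have "((\<lambda>t. (1 + t) *\<^sub>R p) has_derivative (\<lambda>t. t *\<^sub>R p)) (at (0::real))"
    by (auto intro!: derivative_eq_intros)
  ultimately have "M p \<circ> (\<lambda>t. t *\<^sub>R p) = (\<lambda>t. t *\<^sub>R p)"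
    using has_derivative_unique by metis
  from fun_cong[OF this, of 1] show ?thesis by simp
qed

lemma M'_self: "M' p p v = v - M p v"
proof -
  have "((\<lambda>p. M p p) has_derivative (\<lambda>v. M' p p v + M p v)) (at p)"
    by (rule has_derivative_linear_family[OF linear_partial2 deriv_M has_derivative_ident])
  then have "(\<lambda>v. M' p p v + M p v) = (\<lambda>v. v)"
    using has_derivative_unique has_derivative_ident unfolding M_self by blast
  from fun_cong[OF this, of v] show ?thesis by (simp add: eq_diff_eq)
qed

end

text \<open>\<open>p \<mapsto> left_frame m p X\<close> is the left-invariant vector field with value \<open>X\<close> at the identity.\<close>

locale exp_group = exp_coords +
  fixes br :: "'a \<Rightarrow> 'a \<Rightarrow> 'a"
  assumes bracket: "frechet_derivative (\<lambda>p. left_frame m p Y) (at p) (left_frame m p X)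
      - frechet_derivative (\<lambda>p. left_frame m p X) (at p) (left_frame m p Y)
      = left_frame m p (br X Y)"
begin

text \<open>In the bracket relation the point \<open>p\<close> is also taken as the Lie algebra
  element. By \<open>M_self\<close> the derivative along its field is then the radial derivative,
  and \<open>M'_self\<close> evaluates the other term.\<close>

lemma M'_radial: "M' p Y p = M p Y - M p (M p Y) + M p (br p Y)"
  using bracket[of Y p p] M'_self[of p "M p Y"] by (simp add: M_self M'_def diff_eq_eq)

lemma S'_radial: "S' p Z p = Z - S p Z - br p (S p Z)"
proof -
  define Y where "Y = S p Z"
  \<comment> \<open>Differentiating the constant \<open>S x (M x Y) = Y\<close> expresses the
    derivative of \<open>S\<close> through that of \<open>M\<close>, whose radial part is
    known.\<close>
  have "((\<lambda>x. S x (M x Y)) has_derivative (\<lambda>v. S' p (M p Y) v + S p (M' p Y v))) (at p)"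
    by (rule has_derivative_linear_family[OF linear_S deriv_S deriv_M])
  then have "(\<lambda>v. S' p (M p Y) v + S p (M' p Y v)) = (\<lambda>v. 0)"
    using has_derivative_unique has_derivative_const unfolding S_M by blast
  then have "S' p (M p Y) p = - S p (M' p Y p)"
    by (metis add_eq_0_iff2)
  also have "\<dots> = M p Y - Y - br p Y"
    unfolding M'_radial
    by (simp add: linear_add[OF linear_S] linear_diff[OF linear_S] S_M)
  finally show ?thesis by (simp add: Y_def M_S)
qed

lemma M_zero: "M 0 v = v" and S_zero: "S 0 v = v"
  by (simp_all add: S_def partial2_zero_left)

text \<open>At the identity the frame is trivial, so the bracket is an antisymmetrised derivative of
  the frame. Bilinearity of \<open>br\<close> is deduced from this formula.\<close>

lemma bracket_zero: "br X Y = M' 0 Y X - M' 0 X Y"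
  using bracket[of Y 0 X] by (simp add: M_zero M'_def)

lemma linear_M': "linear (\<lambda>Y. M' p Y v)"
proof
  show "M' p (X + Y) v = M' p X v + M' p Y v" for X Y
  proof -
    have "((\<lambda>p. M p (X + Y)) has_derivative (\<lambda>v. M' p X v + M' p Y v)) (at p)"
      unfolding linear_add[OF linear_partial2] by (intro has_derivative_add deriv_M)
    from fun_cong[OF has_derivative_unique[OF this deriv_M], of v] show ?thesis by simp
  qed
  show "M' p (c *\<^sub>R Y) v = c *\<^sub>R M' p Y v" for c Y
  proof -
    have "((\<lambda>p. M p (c *\<^sub>R Y)) has_derivative (\<lambda>v. c *\<^sub>R M' p Y v)) (at p)"
      unfolding linear_cmul[OF linear_partial2] by (intro has_derivative_scaleR_right deriv_M)
    from fun_cong[OF has_derivative_unique[OF this deriv_M], of v] show ?thesis by simp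
  qed
qed

lemma linear_M'2: "linear (M' p Y)"
  by (rule has_derivative_linear[OF deriv_M])

lemma linear_bracket: "linear (br X)" and linear_bracket2: "linear (\<lambda>X. br X Y)"
  unfolding bracket_zero[abs_def] by (intro linear_compose_sub linear_M' linear_M'2)+

text \<open>Its solution is \<open>(1 - exp (- ad (t X))) / ad X\<close>, so that \<open>S p\<close> is the left logarithmic
  derivative of the exponential map.\<close>

lemma S_ode:
  "((\<lambda>t. t *\<^sub>R S (t *\<^sub>R X) Z) has_vector_derivative Z - br X (t *\<^sub>R S (t *\<^sub>R X) Z)) (at t)"
proof -
  have "((\<lambda>p. S p Z) \<circ> (\<lambda>t. t *\<^sub>R X) has_derivative S' (t *\<^sub>R X) Z \<circ> (\<lambda>h. h *\<^sub>R X)) (at t)"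
    by (rule diff_chain_at) (auto intro!: derivative_eq_intros deriv_S)
  then have "((\<lambda>t. t *\<^sub>R S (t *\<^sub>R X) Z) has_derivative
      (\<lambda>h. t *\<^sub>R S' (t *\<^sub>R X) Z (h *\<^sub>R X) + h *\<^sub>R S (t *\<^sub>R X) Z)) (at t)"
    unfolding o_def by (rule has_derivative_scaleR[OF has_derivative_ident])
  moreover have "t *\<^sub>R S' (t *\<^sub>R X) Z (h *\<^sub>R X) + h *\<^sub>R S (t *\<^sub>R X) Z
      = h *\<^sub>R (Z - br X (t *\<^sub>R S (t *\<^sub>R X) Z))" for h
  proof -
    have lin: "linear (S' (t *\<^sub>R X) Z)" by (rule has_derivative_linear[OF deriv_S])
    \<comment> \<open>Moving the factor \<open>t\<close> inside makes the direction equal to the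
      base point, where \<open>S'_radial\<close> applies. No division by \<open>t\<close> occurs, so
      the equation also holds at \<open>t = 0\<close>.\<close>
    have "t *\<^sub>R S' (t *\<^sub>R X) Z (h *\<^sub>R X) = h *\<^sub>R S' (t *\<^sub>R X) Z (t *\<^sub>R X)"
      by (simp add: linear_cmul[OF lin])
    then show ?thesis
      by (simp add: S'_radial linear_cmul[OF linear_bracket] linear_cmul[OF linear_bracket2]
          scaleR_diff_right)
  qed
  ultimately show ?thesis by (simp add: has_vector_derivative_def)
qed

text \<open>Multiplied by \<open>t\<close> and evaluated along the rays, both sides solve the linear
  equation \<open>u' = \<delta> Z - br (\<delta> X) u\<close> with initial value \<open>0\<close>.
  Their difference vanishes by \<open>linear_ode_zero\<close>, and \<open>t = 1\<close> gives the
  claim.\<close>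

lemma S_equivariant:
  assumes "linear \<delta>" and br: "\<And>X Y. \<delta> (br X Y) = br (\<delta> X) (\<delta> Y)"
  shows "S (\<delta> X) (\<delta> Z) = \<delta> (S X Z)"
proof -
  define z where "z t = t *\<^sub>R S (t *\<^sub>R \<delta> X) (\<delta> Z) - \<delta> (t *\<^sub>R S (t *\<^sub>R X) Z)" for t
  have "z 1 = 0"
  proof (rule linear_ode_zero[where B = "br (\<delta> X)"])
    show "(z has_vector_derivative - br (\<delta> X) (z t)) (at t)" for t
    proof -
      have "((\<lambda>t. \<delta> (t *\<^sub>R S (t *\<^sub>R X) Z)) has_vector_derivative
          \<delta> (Z - br X (t *\<^sub>R S (t *\<^sub>R X) Z))) (at t)"
        by (rule bounded_linear.has_vector_derivative[OF _ S_ode])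
          (use assms(1) in \<open>simp add: linear_conv_bounded_linear\<close>)
      from has_vector_derivative_diff[OF S_ode this] show ?thesis
        unfolding z_def by (rule has_vector_derivative_eq_rhs)
          (simp add: linear_diff[OF assms(1)] linear_diff[OF linear_bracket] br)
    qed
  qed (auto simp: z_def linear_bracket linear_0[OF assms(1)])
  then show ?thesis by (simp add: z_def)
qed

end

section \<open>Determinants on Euclidean spaces\<close>

text \<open>Determinants and the change of variables formula are available only for \<open>real ^ 'n\<close>; this
  index type makes them usable on an arbitrary Euclidean space.\<close>

typedef (overloaded) ('a::euclidean_space) basis_index = "{..<DIM('a)}"
  by (rule exI[of _ 0]) simp

instance basis_index :: (euclidean_space) finite
proof
  have "(UNIV :: 'a basis_index set) = Abs_basis_index ` {..<DIM('a)}"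
    by (rule type_definition.univ[OF type_definition_basis_index])
  then show "finite (UNIV :: 'a basis_index set)"
    by (metis finite_imageI finite_lessThan)
qed

text \<open>The change of variables formula used in \<open>lborel_distr_vec\<close> is stated for
  well-ordered finite index types.\<close>

instantiation basis_index :: (euclidean_space) wellorder
begin

definition less_eq_basis_index :: "'a basis_index \<Rightarrow> 'a basis_index \<Rightarrow> bool" where
  "i \<le> j \<longleftrightarrow> Rep_basis_index i \<le> Rep_basis_index j"

definition less_basis_index :: "'a basis_index \<Rightarrow> 'a basis_index \<Rightarrow> bool" where
  "i < j \<longleftrightarrow> Rep_basis_index i < Rep_basis_index j"

instance
proof
  fix P :: "'a basis_index \<Rightarrow> bool" and i
  assume step: "\<And>i. (\<And>j. j < i \<Longrightarrow> P j) \<Longrightarrow> P i"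
  show "P i"
  proof (induction i rule: measure_induct_rule[of Rep_basis_index])
    case (less i)
    then show ?case by (rule step) (simp add: less_basis_index_def)
  qed
qed (auto simp: less_eq_basis_index_def less_basis_index_def Rep_basis_index_inject)

end

definition basis_vec :: "'a::euclidean_space basis_index \<Rightarrow> 'a" where
  "basis_vec = (SOME f. bij_betw f UNIV Basis)"

lemma bij_betw_basis_vec: "bij_betw basis_vec UNIV (Basis :: 'a::euclidean_space set)"
proof -
  have "card (UNIV :: 'a basis_index set) = DIM('a)"
    using type_definition.card[OF type_definition_basis_index] by simp
  then have "\<exists>f :: 'a basis_index \<Rightarrow> 'a. bij_betw f UNIV Basis"
    by (intro finite_same_card_bij) auto
  then show ?thesis unfolding basis_vec_def by (rule someI_ex)
qed

lemma basis_vec_in_Basis [simp]: "basis_vec i \<in> Basis"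
  using bij_betw_basis_vec by (auto simp: bij_betw_def)

lemma inner_basis_vec: "basis_vec i \<bullet> basis_vec j = (if i = j then 1 else 0)"
  using bij_betw_imp_inj_on[OF bij_betw_basis_vec, THEN inj_onD, of i j]
  by (auto simp: inner_Basis)

lemma sum_basis_vec: "(\<Sum>i\<in>UNIV. g (basis_vec i)) = (\<Sum>b\<in>Basis. g b)"
  by (rule sum.reindex_bij_betw[OF bij_betw_basis_vec])

lemma prod_basis_vec: "(\<Prod>i\<in>UNIV. g (basis_vec i)) = (\<Prod>b\<in>Basis. g b)"
  by (rule prod.reindex_bij_betw[OF bij_betw_basis_vec])

definition to_vec :: "'a::euclidean_space \<Rightarrow> real ^ 'a basis_index" where
  "to_vec x = (\<chi> i. x \<bullet> basis_vec i)"

definition of_vec :: "real ^ 'a::euclidean_space basis_index \<Rightarrow> 'a" where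
  "of_vec y = (\<Sum>i\<in>UNIV. (y $ i) *\<^sub>R basis_vec i)"

lemma to_vec_of_vec [simp]: "to_vec (of_vec y) = y"
  by (simp add: to_vec_def of_vec_def vec_eq_iff inner_sum_left inner_basis_vec if_distrib cong: if_cong)

lemma of_vec_to_vec [simp]: "of_vec (to_vec x) = x"
  using sum_basis_vec[of "\<lambda>b. (x \<bullet> b) *\<^sub>R b"]
  by (simp add: to_vec_def of_vec_def euclidean_representation)

lemma linear_to_vec: "linear to_vec"
  by unfold_locales (simp_all add: to_vec_def vec_eq_iff inner_add_left)

lemma linear_of_vec: "linear of_vec"
  by unfold_locales (simp_all add: of_vec_def scaleR_add_left sum.distrib scaleR_sum_right)

lemma of_vec_axis: "of_vec (axis i 1) = basis_vec i"
  by (simp add: of_vec_def axis_def if_distrib if_distribR cong: if_cong)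

section \<open>Determinant, trace and diagonal form of endomorphisms\<close>

definition edet :: "('a::euclidean_space \<Rightarrow> 'a) \<Rightarrow> real" where
  "edet f = det ((\<chi> i j. f (basis_vec j) \<bullet> basis_vec i) :: real ^ 'a basis_index ^ 'a basis_index)"

lemma edet_eq_det_matrix: "edet f = det (matrix (to_vec \<circ> f \<circ> of_vec))"
  by (simp add: edet_def matrix_def to_vec_def of_vec_axis)

lemma edet_id: "edet (\<lambda>x. x) = 1"
  by (simp add: edet_eq_det_matrix o_def flip: id_def)

lemma edet_compose:
  assumes "linear f" "linear g"
  shows "edet (f \<circ> g) = edet f * edet g"
proof -
  have "to_vec \<circ> (f \<circ> g) \<circ> of_vec = (to_vec \<circ> f \<circ> of_vec) \<circ> (to_vec \<circ> g \<circ> of_vec)"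
    by auto
  then show ?thesis
    by (simp only: edet_eq_det_matrix matrix_compose det_mul linear_compose linear_to_vec
        linear_of_vec assms)
qed

text \<open>By the Leibniz formula the determinant is a polynomial in the matrix entries, so
  convergence on basis vectors suffices.\<close>

lemma tendsto_edet:
  assumes "\<And>b. b \<in> Basis \<Longrightarrow> ((\<lambda>x. f x b) \<longlongrightarrow> g b) F"
  shows "((\<lambda>x. edet (f x)) \<longlongrightarrow> edet g) F"
  unfolding edet_def det_def by (auto intro!: tendsto_intros assms)

text \<open>Normal form of the generator of dilations after a change of basis: powers, exponential,
  determinant and trace can all be read off from \<open>k\<close>.\<close>

definition diag_map :: "('a::euclidean_space \<Rightarrow> real) \<Rightarrow> 'a \<Rightarrow> 'a" where
  "diag_map k x = (\<Sum>b\<in>Basis. (k b * (x \<bullet> b)) *\<^sub>R b)"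

lemma linear_diag_map: "linear (diag_map k)"
  by unfold_locales
    (simp_all add: diag_map_def inner_add_left scaleR_add_left distrib_left sum.distrib
      scaleR_sum_right mult_ac)

lemma inner_diag_map: "b \<in> Basis \<Longrightarrow> diag_map k x \<bullet> b = k b * (x \<bullet> b)"
  by (simp add: diag_map_def)

lemma diag_map_Basis: "b \<in> Basis \<Longrightarrow> diag_map k b = k b *\<^sub>R b"
  by (simp add: diag_map_def inner_Basis if_distrib if_distribR cong: if_cong)

lemma diag_map_compose: "diag_map k (diag_map l x) = diag_map (\<lambda>b. k b * l b) x"
  by (rule euclidean_eqI) (simp add: inner_diag_map)

lemma diag_map_one: "diag_map (\<lambda>b. 1) x = x"
  by (simp add: diag_map_def euclidean_representation)

lemma edet_diag_map: "edet (diag_map k :: 'a::euclidean_space \<Rightarrow> 'a) = (\<Prod>b\<in>Basis. k b)"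
proof -
  have "edet (diag_map k :: 'a \<Rightarrow> 'a)
      = (\<Prod>i\<in>UNIV. ((\<chi> i j. diag_map k (basis_vec j) \<bullet> basis_vec i)
          :: real ^ 'a basis_index ^ 'a basis_index) $ i $ i)"
    unfolding edet_def
    by (rule det_diagonal) (simp add: inner_basis_vec inner_diag_map)
  also have "\<dots> = (\<Prod>i\<in>UNIV. k (basis_vec i :: 'a))"
    by (simp add: inner_diag_map inner_basis_vec)
  finally show ?thesis by (simp add: prod_basis_vec)
qed

lemma lin_trace_diag_map: "lin_trace (diag_map k) = (\<Sum>b\<in>Basis. k b)"
  by (simp add: lin_trace_def inner_diag_map)

lemma lin_trace_compose_commute:
  fixes f g :: "'a::euclidean_space \<Rightarrow> 'a"
  assumes "linear f" "linear g"
  shows "lin_trace (f \<circ> g) = lin_trace (g \<circ> f)"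
proof -
  \<comment> \<open>Written in matrix entries, the trace of the product is a double sum in which
    exchanging \<open>f\<close> and \<open>g\<close> amounts to exchanging the order of
    summation.\<close>
  have "lin_trace (f \<circ> g) = (\<Sum>b\<in>Basis. \<Sum>c\<in>Basis. (g b \<bullet> c) * (f c \<bullet> b))"
    if "linear f" for f g :: "'a \<Rightarrow> 'a"
    unfolding lin_trace_def comp_apply
    by (subst linear_euclidean_expansion[OF that]) (simp add: inner_sum_left)
  from this[OF assms(1)] this[OF assms(2)] show ?thesis
    by (subst (asm) (2) sum.swap) (simp add: mult.commute)
qed

lemma edet_conj:
  fixes f P P' :: "'a::euclidean_space \<Rightarrow> 'a"
  assumes "linear P" "linear P'" "linear f" "\<And>x. P (P' x) = x"
  shows "edet (P \<circ> f \<circ> P') = edet f"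
proof -
  have "P \<circ> P' = (\<lambda>x. x)" using assms(4) by auto
  then have "edet P * edet P' = 1"
    using edet_compose[OF assms(1,2)] edet_id by metis
  moreover have "edet (P \<circ> f \<circ> P') = edet P * edet f * edet P'"
    using assms(1-3) by (simp only: edet_compose linear_compose)
  ultimately show ?thesis by algebra
qed

lemma lin_trace_conj:
  fixes f P P' :: "'a::euclidean_space \<Rightarrow> 'a"
  assumes "linear P" "linear P'" "linear f" "\<And>x. P' (P x) = x"
  shows "lin_trace (P \<circ> f \<circ> P') = lin_trace f"
proof -
  have "lin_trace (P \<circ> f \<circ> P') = lin_trace (P' \<circ> (P \<circ> f))"
    using assms(1-3) linear_compose by (intro lin_trace_compose_commute) blast+
  also have "P' \<circ> (P \<circ> f) = f" using assms(4) by auto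
  finally show ?thesis .
qed

text \<open>Take for \<open>P\<close> the map sending the standard basis bijectively onto an
  eigenbasis. Its range contains a spanning set, so it is onto and hence invertible. It need not be
  orthogonal, which is why an explicit inverse \<open>P'\<close> is carried along.\<close>

lemma diagonalisable_imp_conj_diag_map:
  fixes A :: "'a::euclidean_space \<Rightarrow> 'a"
  assumes "diagonalisable A"
  obtains P P' :: "'a \<Rightarrow> 'a" and k where "linear P" "linear P'" "\<And>x. P' (P x) = x" "\<And>x. P (P' x) = x"
    "A = P \<circ> diag_map k \<circ> P'"
proof -
  obtain B where "linear A" "independent B" "span B = UNIV" "\<forall>b\<in>B. \<exists>c. A b = c *\<^sub>R b"
    using assms by (auto simp: diagonalisable_def)
  then obtain c where A: "\<And>b. b \<in> B \<Longrightarrow> A b = c b *\<^sub>R b" by metis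
  have "finite B" using \<open>independent B\<close> by (rule finiteI_independent)
  moreover have "card B = DIM('a)"
    using dim_eq_card_independent[OF \<open>independent B\<close>] dim_span[of B]
    by (simp add: \<open>span B = UNIV\<close>)
  ultimately obtain h where h: "bij_betw h (Basis :: 'a set) B"
    using finite_same_card_bij[of Basis B] by auto
  obtain P where P: "linear P" "\<And>b. b \<in> Basis \<Longrightarrow> P b = h b"
    using linear_independent_extend[OF independent_Basis, of h] by blast
  have "surj P"
  proof -
    have "P ` Basis = B"
      using bij_betw_imp_surj_on[OF h] P(2) by (simp cong: image_cong)
    then have "B \<subseteq> range P" by blast
    then have "span B \<subseteq> range P"
      using span_minimal linear_subspace_image[OF P(1) subspace_UNIV] by blast
    then show ?thesis using \<open>span B = UNIV\<close> by auto
  qed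
  then obtain P' where P': "linear P'" "\<And>x. P' (P x) = x" "\<And>x. P (P' x) = x"
    using linear_surjective_isomorphism[OF P(1)] by metis
  have "A \<circ> P = P \<circ> diag_map (c \<circ> h)"
  proof (rule linear_eq_stdbasis)
    show "linear (A \<circ> P)" "linear (P \<circ> diag_map (c \<circ> h))"
      using \<open>linear A\<close> P(1) linear_diag_map linear_compose by blast+
    show "(A \<circ> P) b = (P \<circ> diag_map (c \<circ> h)) b" if "b \<in> Basis" for b
    proof -
      have "h b \<in> B" using h that by (auto simp: bij_betw_def)
      then show ?thesis
        using A P that by (simp add: diag_map_Basis linear_cmul)
    qed
  qed
  then have "A = P \<circ> diag_map (c \<circ> h) \<circ> P'"
    using P'(3) by (metis comp_assoc comp_id eq_id_iff o_def)
  from that[OF P(1) P'(1) P'(2) P'(3) this] show thesis .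
qed

section \<open>Lebesgue measure and maps of constant Jacobian\<close>

lemma lborel_of_vec: "distr lborel borel of_vec = (lborel :: 'a::euclidean_space measure)"
proof (rule lborel_eqI[symmetric])
  fix l u :: 'a
  assume "\<And>b. b \<in> Basis \<Longrightarrow> l \<bullet> b \<le> u \<bullet> b"
  then have le: "l \<bullet> basis_vec i \<le> u \<bullet> basis_vec i" for i by simp
  have [measurable]: "of_vec \<in> borel_measurable (borel :: (real ^ 'a basis_index) measure)"
    using linear_continuous_on linear_of_vec linear_conv_bounded_linear
    by (intro borel_measurable_continuous_onI) blast
  \<comment> \<open>The enumeration only relabels orthonormal coordinates, so boxes correspond to
    boxes with the same side lengths.\<close>
  have "of_vec -` box l u = box (to_vec l) (to_vec u)"
  proof -
    have inner: "of_vec y \<bullet> basis_vec i = y $ i" for y :: "real ^ 'a basis_index" and i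
      by (simp add: of_vec_def inner_sum_left inner_basis_vec if_distrib cong: if_cong)
    have "Basis = range (basis_vec :: _ \<Rightarrow> 'a)"
      using bij_betw_basis_vec by (auto simp: bij_betw_def)
    then have "(\<forall>b\<in>Basis. Q b) \<longleftrightarrow> (\<forall>i. Q (basis_vec i))" for Q :: "'a \<Rightarrow> bool"
      by (metis rangeE rangeI)
    then show ?thesis
      by (auto simp: box_def to_vec_def Basis_vec_def inner_axis inner)
  qed
  then have "emeasure (distr lborel borel of_vec) (box l u) = emeasure lborel (box (to_vec l) (to_vec u))"
    by (simp add: emeasure_distr)
  also have "\<dots> = (\<Prod>b\<in>Basis. (to_vec u - to_vec l) \<bullet> b)"
    using le by (intro emeasure_lborel_box) (auto simp: to_vec_def Basis_vec_def inner_axis)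
  also have "(\<Prod>b\<in>Basis. (to_vec u - to_vec l) \<bullet> b) = (\<Prod>i\<in>UNIV. (u - l) \<bullet> basis_vec i)"
  proof -
    have "bij_betw (\<lambda>i. axis i 1) UNIV (Basis :: (real ^ 'a basis_index) set)"
      by (auto simp: bij_betw_def Basis_vec_def inj_on_def axis_eq_axis)
    then have "(\<Prod>b\<in>Basis. (to_vec u - to_vec l) \<bullet> b) = (\<Prod>i\<in>UNIV. (to_vec u - to_vec l) \<bullet> axis i 1)"
      by (rule prod.reindex_bij_betw[symmetric])
    then show ?thesis
      by (simp add: inner_axis to_vec_def inner_diff_left)
  qed
  also have "\<dots> = (\<Prod>b\<in>Basis. (u - l) \<bullet> b)"
    by (rule prod_basis_vec)
  finally show "emeasure (distr lborel borel of_vec) (box l u) = (\<Prod>b\<in>Basis. (u - l) \<bullet> b)" .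
qed simp

text \<open>With constant Jacobian \<open>c\<close>, the preimage of a box has \<open>1 / c\<close>
  times its volume, and the density restores the factor. Values on boxes determine Lebesgue
  measure.\<close>

lemma lborel_distr_vec:
  fixes \<psi> :: "real ^ 'n::{finite,wellorder} \<Rightarrow> real ^ 'n::_"
  assumes "bij \<psi>" "\<And>x. (\<psi> has_derivative \<psi>' x) (at x)" "\<And>x. \<bar>det (matrix (\<psi>' x))\<bar> = c" "c > 0"
  shows "lborel = density (distr lborel borel \<psi>) (\<lambda>_. ennreal c)"
proof (rule lborel_eqI)
  fix l u :: "real ^ 'n::{finite,wellorder}"
  assume le: "\<And>b. b \<in> Basis \<Longrightarrow> l \<bullet> b \<le> u \<bullet> b"
  have "continuous_on UNIV \<psi>"
    using assms(2) has_derivative_continuous by (metis continuous_on_eq_continuous_within)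
  then have [measurable]: "\<psi> \<in> borel_measurable borel"
    by (rule borel_measurable_continuous_onI)
  define T where "T = \<psi> -` box l u"
  have T: "\<psi> ` T = box l u" "T \<in> sets borel" "inj_on \<psi> T"
    using assms(1) measurable_sets_borel[of \<psi> borel "box l u"]
    by (auto simp: T_def bij_def surj_image_vimage_eq inj_on_def)
  have "(\<psi> has_derivative \<psi>' x) (at x within T)" for x
    using assms(2) has_derivative_at_withinI by blast
  then have "((\<lambda>x. c) has_integral measure lebesgue (box l u)) T"
    using has_measure_differentiable_image[of T \<psi> \<psi>' "measure lebesgue (box l u)"] T assms(3)
    by auto
  \<comment> \<open>Change of variables gives the integral of \<open>c\<close> over
    \<open>T\<close>. Dividing by \<open>c\<close> makes the constant \<open>1\<close> integrable
    there, which yields both finite measure and its value.\<close>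
  then have "((\<lambda>x. c / c) has_integral measure lebesgue (box l u) / c) T"
    by (rule has_integral_divide)
  then have 1: "((\<lambda>x. 1) has_integral measure lebesgue (box l u) / c) T"
    using \<open>c > 0\<close> by simp
  then have Tm: "T \<in> lmeasurable" "measure lebesgue T = measure lebesgue (box l u) / c"
    by (auto simp: lmeasurable_iff_integrable_on lmeasure_integral has_integral_iff)
  have "emeasure (density (distr lborel borel \<psi>) (\<lambda>_. ennreal c)) (box l u)
      = c * emeasure lborel T"
    by (simp add: emeasure_density nn_integral_cmult_indicator emeasure_distr T_def)
  also have "emeasure lborel T = emeasure lebesgue T"
    using T(2) by simp
  also have "\<dots> = ennreal (measure lebesgue (box l u) / c)"
    using Tm by (metis emeasure_eq_measure2 fmeasurableD fmeasurableD2 emeasure_eq_ennreal_measure top.not_eq_extremum)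
  also have "ennreal c * \<dots> = ennreal (measure lebesgue (box l u))"
    using \<open>c > 0\<close> by (simp flip: ennreal_mult)
  also have "measure lebesgue (box l u) = (\<Prod>b\<in>Basis. (u - l) \<bullet> b)"
    using le by (simp add: measure_lborel_box_eq)
  finally show "emeasure (density (distr lborel borel \<psi>) (\<lambda>_. ennreal c)) (box l u)
      = (\<Prod>b\<in>Basis. (u - l) \<bullet> b)" .
qed simp

lemma lborel_distr_edet:
  fixes \<phi> :: "'a::euclidean_space \<Rightarrow> 'a"
  assumes "bij \<phi>" and D: "\<And>x. (\<phi> has_derivative \<phi>' x) (at x)"
    and det: "\<And>x. \<bar>edet (\<phi>' x)\<bar> = c" "c > 0"
  shows "lborel = density (distr lborel borel \<phi>) (\<lambda>_. ennreal c)"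
proof (rule measure_eqI)
  fix B :: "'a set"
  assume "B \<in> sets lborel"
  then have [measurable]: "B \<in> sets borel" by simp
  define \<psi> where "\<psi> = to_vec \<circ> \<phi> \<circ> of_vec"
  have bij_vec: "bij (to_vec :: 'a \<Rightarrow> _)" "bij (of_vec :: _ \<Rightarrow> 'a)"
    by (rule bij_betw_byWitness[where f' = of_vec], auto)
      (rule bij_betw_byWitness[where f' = to_vec], auto)
  have "bij \<psi>"
    unfolding \<psi>_def using assms(1) bij_vec by (intro bij_comp)
  have "(\<psi> has_derivative to_vec \<circ> \<phi>' (of_vec y) \<circ> of_vec) (at y)" for y
    unfolding \<psi>_def
    using linear_of_vec linear_to_vec D linear_imp_has_derivative diff_chain_at by metis
  note lborel_vec = lborel_distr_vec[OF \<open>bij \<psi>\<close> this, of c]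
  have "continuous_on UNIV \<phi>"
    using D has_derivative_continuous by (metis continuous_on_eq_continuous_within)
  then have \<phi> [measurable]: "\<phi> \<in> borel_measurable borel"
    by (rule borel_measurable_continuous_onI)
  have [measurable]: "of_vec \<in> borel_measurable (borel :: (real ^ 'a basis_index) measure)"
    "to_vec \<in> borel_measurable (borel :: 'a measure)"
    using linear_continuous_on linear_of_vec linear_to_vec linear_conv_bounded_linear
    by (intro borel_measurable_continuous_onI; blast)+
  have [measurable]: "\<psi> \<in> borel_measurable borel" by (simp add: \<psi>_def)
  have [measurable]: "of_vec -` B \<in> sets borel"
    by (rule measurable_sets_borel) measurable
  have "emeasure (density (distr lborel borel \<phi>) (\<lambda>_. ennreal c)) B = c * emeasure lborel (\<phi> -` B)"
    by (simp add: emeasure_density nn_integral_cmult_indicator emeasure_distr)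
  also have "\<dots> = c * emeasure (distr lborel borel of_vec) (\<phi> -` B)"
    by (simp add: lborel_of_vec)
  also have "\<dots> = c * emeasure lborel (of_vec -` \<phi> -` B)"
    by (simp add: emeasure_distr measurable_sets_borel[OF \<phi>])
  \<comment> \<open>The map \<psi> is \<phi> conjugated by the coordinates, so
    \<open>of_vec \<circ> \<psi> = \<phi> \<circ> of_vec\<close>.\<close>
  also have "of_vec -` \<phi> -` B = \<psi> -` of_vec -` B"
    by (simp add: \<psi>_def vimage_def)
  also have "c * emeasure lborel (\<psi> -` of_vec -` B)
      = emeasure (density (distr lborel borel \<psi>) (\<lambda>_. ennreal c)) (of_vec -` B)"
    by (simp add: emeasure_density nn_integral_cmult_indicator emeasure_distr measurable_sets_borel)
  also have "\<dots> = emeasure lborel (of_vec -` B)"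
    using lborel_vec det by (simp add: edet_eq_det_matrix)
  also have "\<dots> = emeasure (distr lborel borel of_vec) B"
    by (simp add: emeasure_distr)
  also have "\<dots> = emeasure lborel B"
    by (simp add: lborel_of_vec)
  finally show "emeasure lborel B = emeasure (density (distr lborel borel \<phi>) (\<lambda>_. ennreal c)) B" ..
qed simp

section \<open>Invariant measures\<close>

lemma integral_lborel_linear:
  fixes \<delta> :: "'a::euclidean_space \<Rightarrow> 'a" and f :: "'a \<Rightarrow> 'b::{banach, second_countable_topology}"
  assumes "linear \<delta>" "bij \<delta>" "edet \<delta> > 0" and [measurable]: "f \<in> borel_measurable borel"
  shows "(\<integral>x. f x \<partial>lborel) = edet \<delta> *\<^sub>R (\<integral>x. f (\<delta> x) \<partial>lborel)"
proof -
  have [measurable]: "\<delta> \<in> borel_measurable borel"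
    using assms(1) linear_continuous_on linear_conv_bounded_linear
    by (intro borel_measurable_continuous_onI) blast
  have "density (distr lborel borel \<delta>) (\<lambda>_. ennreal (edet \<delta>)) = lborel"
    using assms(1-3) linear_imp_has_derivative
    by (intro lborel_distr_edet[where \<phi>' = "\<lambda>_. \<delta>", symmetric]) auto
  then have "(\<integral>x. f x \<partial>lborel) = (\<integral>x. f x \<partial>density (distr lborel borel \<delta>) (\<lambda>_. ennreal (edet \<delta>)))"
    by simp
  also have "\<dots> = edet \<delta> *\<^sub>R (\<integral>x. f (\<delta> x) \<partial>lborel)"
    using assms(3) by (simp add: integral_density integral_distr)
  finally show ?thesis .
qed

context exp_group
begin

lemma edet_S:
  fixes \<delta> :: "real \<Rightarrow> 'a \<Rightarrow> 'a"
  assumes "\<And>r. r > 0 \<Longrightarrow> linear (\<delta> r)" "\<And>r. r > 0 \<Longrightarrow> edet (\<delta> r) \<noteq> 0"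
    and "\<And>r X Y. r > 0 \<Longrightarrow> \<delta> r (br X Y) = br (\<delta> r X) (\<delta> r Y)"
    and "((\<lambda>r. \<delta> r p) \<longlongrightarrow> 0) (at_right 0)"
  shows "edet (S p) = 1"
proof -
  have eq: "edet (S (\<delta> r p)) = edet (S p)" if "r > 0" for r
  proof -
    \<comment> \<open>This is an intertwining relation: \<open>S\<close> at the dilated point is
      conjugate to \<open>S p\<close> by the invertible map \<open>\<delta> r\<close>, so their
      determinants agree.\<close>
    have "S (\<delta> r p) \<circ> \<delta> r = \<delta> r \<circ> S p"
      using S_equivariant[OF assms(1)[OF that] assms(3)[OF that]] by auto
    then have "edet (S (\<delta> r p)) * edet (\<delta> r) = edet (\<delta> r) * edet (S p)"
      using assms(1)[OF that] linear_S edet_compose by metis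
    then show ?thesis using assms(2)[OF that] by simp
  qed
  have "((\<lambda>r. edet (S (\<delta> r p))) \<longlongrightarrow> edet (S 0)) (at_right 0)"
  proof (rule tendsto_edet)
    fix b
    have "isCont (\<lambda>p. S p b) 0"
      using deriv_S has_derivative_continuous by blast
    then show "((\<lambda>r. S (\<delta> r p) b) \<longlongrightarrow> S 0 b) (at_right 0)"
      using isCont_tendsto_compose assms(4) by blast
  qed
  also have "edet (S 0) = 1"
    by (simp add: S_zero[abs_def] edet_id)
  finally have "((\<lambda>r. edet (S (\<delta> r p))) \<longlongrightarrow> 1) (at_right 0)" .
  moreover have "\<forall>\<^sub>F r in at_right 0. edet (S (\<delta> r p)) = edet (S p)"
    using eventually_at_right_less[of "0::real"] by eventually_elim (rule eq)
  ultimately have "((\<lambda>r::real. edet (S p)) \<longlongrightarrow> 1) (at_right 0)"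
    by (rule Lim_transform_eventually)
  then show ?thesis
    by (simp add: tendsto_const_iff trivial_limit_at_right_real)
qed

text \<open>Inversion is linear in these coordinates and reverses products; this trades right
  translations for left ones in \<open>nn_integral_m_right\<close>.\<close>

lemma uminus_m: "- m p q = m (- q) (- p)"
proof -
  have inv: "a = - b" if "m a b = 0" for a b
    using assoc[of a b "- b"] that by (simp add: minus_right zero_right zero_left)
  have "m (m (- q) (- p)) (m p q) = m (- q) (m (m (- p) p) q)"
    by (simp only: assoc)
  then have "m (m (- q) (- p)) (m p q) = 0"
    by (simp add: minus_left zero_left)
  from inv[OF this] show ?thesis by simp
qed

lemma bij_m: "bij (m g)"
  by (rule bij_betw_byWitness[where f' = "m (- g)"])
    (auto simp: minus_left minus_right zero_left simp flip: assoc)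

lemma measurable_m [measurable]:
  assumes "a \<in> borel_measurable N" "b \<in> borel_measurable N"
  shows "(\<lambda>x. m (a x) (b x)) \<in> borel_measurable N"
proof -
  have "(\<lambda>z. m (fst z) (snd z)) \<in> borel_measurable borel"
    using smooth_on_imp_continuous_on[OF smooth_m] by (rule borel_measurable_continuous_onI)
  then have "(\<lambda>z. m (fst z) (snd z)) \<in> borel_measurable (borel \<Otimes>\<^sub>M borel)"
    by (simp add: borel_prod)
  from measurable_compose[OF measurable_Pair[OF assms] this] show ?thesis by simp
qed

end

section \<open>Invariance of Lebesgue measure and uniqueness of Haar measure\<close>

locale unimodular_exp_group = exp_group +
  assumes edet_S_1: "edet (S p) = 1"
begin

text \<open>By \<open>partial2_eq\<close> the Jacobian of a translation factors as \<open>M\<close>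
  at the target times \<open>S\<close> at the source. The latter has determinant \<open>1\<close> by
  assumption, and the former because it is inverse to some \<open>S\<close>.\<close>

lemma edet_partial2: "edet (partial2 m g p) = 1"
proof -
  have "M (m g p) \<circ> S (m g p) = (\<lambda>v. v)" by (auto simp: M_S)
  then have "edet (M (m g p)) = 1"
    using edet_compose[OF linear_partial2 linear_S] edet_id edet_S_1 by (metis mult.right_neutral)
  moreover have "partial2 m g p = M (m g p) \<circ> S p"
    by (rule ext) (simp only: comp_apply partial2_eq[of g p])
  ultimately show ?thesis
    by (simp only: edet_compose[OF linear_partial2 linear_S] edet_S_1 mult_1_right)
qed

lemma lborel_left_invariant: "distr lborel borel (m g) = lborel"
proof -
  have "density (distr lborel borel (m g)) (\<lambda>_. ennreal 1) = lborel"
    by (rule lborel_distr_edet[OF bij_m has_derivative_m2, symmetric]) (simp_all add: edet_partial2)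
  then show ?thesis by (simp add: density_1)
qed

lemma nn_integral_m_left:
  assumes [measurable]: "f \<in> borel_measurable borel"
  shows "(\<integral>\<^sup>+x. f (m g x) \<partial>lborel) = (\<integral>\<^sup>+x. f x \<partial>lborel)"
proof -
  have "(\<integral>\<^sup>+x. f x \<partial>distr lborel borel (m g)) = (\<integral>\<^sup>+x. f (m g x) \<partial>lborel)"
    by (intro nn_integral_distr) measurable
  then show ?thesis by (simp add: lborel_left_invariant)
qed

lemma nn_integral_uminus:
  fixes f :: "'a \<Rightarrow> ennreal"
  assumes [measurable]: "f \<in> borel_measurable borel"
  shows "(\<integral>\<^sup>+x. f (- x) \<partial>lborel) = (\<integral>\<^sup>+x. f x \<partial>lborel)"
proof -
  have "distr lborel borel (uminus :: 'a \<Rightarrow> 'a) = lborel"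
    by (subst (2) lborel_affine[of "-1" 0]) (simp_all add: density_1)
  then have "(\<integral>\<^sup>+x. f x \<partial>lborel) = (\<integral>\<^sup>+x. f x \<partial>distr lborel borel uminus)"
    by simp
  also have "\<dots> = (\<integral>\<^sup>+x. f (- x) \<partial>lborel)"
    by (intro nn_integral_distr) measurable
  finally show ?thesis ..
qed

text \<open>A right translation is a left translation conjugated by \<open>x \<mapsto> - x\<close>,
  and Lebesgue measure is preserved by both.\<close>

lemma nn_integral_m_right:
  fixes f :: "'a \<Rightarrow> ennreal"
  assumes [measurable]: "f \<in> borel_measurable borel"
  shows "(\<integral>\<^sup>+y. f (m y x) \<partial>lborel) = (\<integral>\<^sup>+x. f x \<partial>lborel)"
proof -
  have "(\<integral>\<^sup>+y. f (m y x) \<partial>lborel) = (\<integral>\<^sup>+y. f (- m (- x) (- y)) \<partial>lborel)"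
    by (simp add: uminus_m)
  also have "\<dots> = (\<integral>\<^sup>+y. f (- m (- x) y) \<partial>lborel)"
    by (rule nn_integral_uminus[of "\<lambda>y. f (- m (- x) y)"]) measurable
  also have "\<dots> = (\<integral>\<^sup>+y. f (- y) \<partial>lborel)"
    by (rule nn_integral_m_left[of "\<lambda>y. f (- y)"]) measurable
  also have "\<dots> = (\<integral>\<^sup>+x. f x \<partial>lborel)"
    by (rule nn_integral_uminus) measurable
  finally show ?thesis .
qed

text \<open>Uniqueness of Haar measure: since Lebesgue measure is invariant under right translations
  and inversion, integrating \<open>f x * g (y x)\<close> in both orders separates the two factors.\<close>

lemma left_invariant_measure_eq:
  assumes [simp, measurable_cong]: "sets \<nu> = sets borel"
    and inv: "\<And>g. distr \<nu> borel (m g) = \<nu>"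
    and fin: "\<And>K. compact K \<Longrightarrow> emeasure \<nu> K < \<infinity>"
  shows "\<exists>\<kappa>\<ge>0. \<nu> = density lborel (\<lambda>_. ennreal \<kappa>)"
proof -
  have space: "space \<nu> = UNIV"
    using sets_eq_imp_space_eq[OF assms(1)] by simp
  \<comment> \<open>Closed balls of integer radius are compact and exhaust the space; the resulting
    sigma-finiteness is required for Tonelli's theorem.\<close>
  interpret \<nu>: sigma_finite_measure \<nu>
  proof
    show "\<exists>A. countable A \<and> A \<subseteq> sets \<nu> \<and> \<Union>A = space \<nu> \<and> (\<forall>a\<in>A. emeasure \<nu> a \<noteq> \<infinity>)"
    proof (intro exI conjI)
      show "\<Union>(range (\<lambda>n::nat. cball (0::'a) (real n))) = space \<nu>"
        using real_arch_simple by (auto simp: space)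
      show "\<forall>a\<in>range (\<lambda>n::nat. cball (0::'a) (real n)). emeasure \<nu> a \<noteq> \<infinity>"
        using fin[OF compact_cball] by (auto simp: less_top)
    qed auto
  qed
  interpret P: pair_sigma_finite \<nu> "lborel :: 'a measure" ..
  have \<nu>_left: "(\<integral>\<^sup>+x. f (m g x) \<partial>\<nu>) = (\<integral>\<^sup>+x. f x \<partial>\<nu>)"
    if [measurable]: "f \<in> borel_measurable borel" for f g
  proof -
    have "(\<integral>\<^sup>+x. f x \<partial>distr \<nu> borel (m g)) = (\<integral>\<^sup>+x. f (m g x) \<partial>\<nu>)"
      by (intro nn_integral_distr) measurable
    then show ?thesis by (simp add: inv)
  qed
  have key: "(\<integral>\<^sup>+x. f x \<partial>\<nu>) * (\<integral>\<^sup>+x. g x \<partial>lborel) = (\<integral>\<^sup>+x. g x \<partial>\<nu>) * (\<integral>\<^sup>+x. f x \<partial>lborel)"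
    if [measurable]: "f \<in> borel_measurable borel" "g \<in> borel_measurable borel"
    for f g :: "'a \<Rightarrow> ennreal"
  proof -
    \<comment> \<open>By right invariance the inner integral does not depend on \<open>x\<close>, so
      the integral of \<open>g\<close> can be inserted in this twisted form.\<close>
    have "(\<integral>\<^sup>+x. f x \<partial>\<nu>) * (\<integral>\<^sup>+x. g x \<partial>lborel) = (\<integral>\<^sup>+x. f x * (\<integral>\<^sup>+y. g (m y x) \<partial>lborel) \<partial>\<nu>)"
      by (simp add: nn_integral_m_right nn_integral_multc)
    also have "\<dots> = (\<integral>\<^sup>+x. \<integral>\<^sup>+y. f x * g (m y x) \<partial>lborel \<partial>\<nu>)"
      by (intro nn_integral_cong nn_integral_cmult[symmetric]) measurable
    also have "\<dots> = (\<integral>\<^sup>+y. \<integral>\<^sup>+x. f x * g (m y x) \<partial>\<nu> \<partial>lborel)"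
      by (rule P.Fubini'[symmetric]) measurable
    \<comment> \<open>For fixed \<open>y\<close>, left invariance of \<nu> moves the translation
      from \<open>g\<close> to \<open>f\<close>.\<close>
    also have "\<dots> = (\<integral>\<^sup>+y. \<integral>\<^sup>+x. f (m (- y) x) * g x \<partial>\<nu> \<partial>lborel)"
    proof (rule nn_integral_cong)
      fix y
      have "(\<integral>\<^sup>+x. f (m (- y) (m y x)) * g (m y x) \<partial>\<nu>) = (\<integral>\<^sup>+x. f (m (- y) x) * g x \<partial>\<nu>)"
        by (rule \<nu>_left[of "\<lambda>x. f (m (- y) x) * g x"]) measurable
      then show "(\<integral>\<^sup>+x. f x * g (m y x) \<partial>\<nu>) = (\<integral>\<^sup>+x. f (m (- y) x) * g x \<partial>\<nu>)"
        by (simp add: minus_left zero_left flip: assoc)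
    qed
    also have "\<dots> = (\<integral>\<^sup>+x. \<integral>\<^sup>+y. f (m (- y) x) * g x \<partial>lborel \<partial>\<nu>)"
      by (rule P.Fubini') measurable
    also have "\<dots> = (\<integral>\<^sup>+x. (\<integral>\<^sup>+y. f (m (- y) x) \<partial>lborel) * g x \<partial>\<nu>)"
      by (intro nn_integral_cong nn_integral_multc) measurable
    also have "\<dots> = (\<integral>\<^sup>+x. (\<integral>\<^sup>+y. f y \<partial>lborel) * g x \<partial>\<nu>)"
    proof (rule nn_integral_cong)
      fix x
      have "(\<integral>\<^sup>+y. f (m (- y) x) \<partial>lborel) = (\<integral>\<^sup>+y. f (m y x) \<partial>lborel)"
        by (rule nn_integral_uminus[of "\<lambda>y. f (m y x)"]) measurable
      then show "(\<integral>\<^sup>+y. f (m (- y) x) \<partial>lborel) * g x = (\<integral>\<^sup>+y. f y \<partial>lborel) * g x"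
        by (simp add: nn_integral_m_right)
    qed
    also have "\<dots> = (\<integral>\<^sup>+x. f x \<partial>lborel) * (\<integral>\<^sup>+x. g x \<partial>\<nu>)"
      by (rule nn_integral_cmult) measurable
    finally show ?thesis by (simp add: mult.commute)
  qed
  \<comment> \<open>Testing against the unit cube, of Lebesgue measure \<open>1\<close>, identifies
    the constant as its \<nu>-measure.\<close>
  define C where "C = cbox (0 :: 'a) One"
  have C: "emeasure lborel C = 1" "C \<in> sets borel"
    by (simp_all add: C_def emeasure_lborel_cbox_eq)
  have "emeasure \<nu> C < \<infinity>" unfolding C_def by (rule fin[OF compact_cbox])
  then obtain \<kappa> where \<kappa>: "\<kappa> \<ge> 0" "emeasure \<nu> C = ennreal \<kappa>"
    by (cases "emeasure \<nu> C") auto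
  have "\<nu> = density lborel (\<lambda>_. ennreal \<kappa>)"
  proof (rule measure_eqI)
    fix A assume "A \<in> sets \<nu>"
    then have [measurable]: "A \<in> sets borel" by simp
    have "emeasure \<nu> A * emeasure lborel C = emeasure \<nu> C * emeasure lborel A"
      using key[of "indicator A" "indicator C"] C(2) by simp
    then show "emeasure \<nu> A = emeasure (density lborel (\<lambda>_. ennreal \<kappa>)) A"
      using C \<kappa> by (simp add: emeasure_density nn_integral_cmult_indicator)
  qed simp
  with \<kappa>(1) show ?thesis by blast
qed

end

section \<open>Dilations and quasi-norms\<close>

text \<open>Powers commute with conjugation and act entrywise on diagonal maps, so the exponential
  series becomes a scalar exponential series in each coordinate.\<close>

lemma alg_dilation_conj_diag_map:
  fixes P P' :: "'a::euclidean_space \<Rightarrow> 'a"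
  assumes "linear P" "linear P'" "\<And>x. P' (P x) = x" "\<And>x. P (P' x) = x"
  shows "alg_dilation (P \<circ> diag_map k \<circ> P') r X = P (diag_map (\<lambda>b. exp (k b * ln r)) (P' X))"
proof -
  have pow: "((\<lambda>Y. ln r *\<^sub>R (P \<circ> diag_map k \<circ> P') Y) ^^ n) X
      = P (diag_map (\<lambda>b. (k b * ln r) ^ n) (P' X))" for n
  proof (induction n)
    case 0
    then show ?case by (simp add: diag_map_one assms)
  next
    case (Suc n)
    have "diag_map (\<lambda>b. (k b * ln r) ^ Suc n) (P' X)
        = ln r *\<^sub>R diag_map k (diag_map (\<lambda>b. (k b * ln r) ^ n) (P' X))"
      by (rule euclidean_eqI) (simp add: inner_diag_map)
    with Suc show ?case
      by (simp add: assms linear_cmul[OF assms(1)])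
  qed
  have "(\<lambda>n. (1 / fact n) *\<^sub>R diag_map (\<lambda>b. (k b * ln r) ^ n) (P' X))
      sums diag_map (\<lambda>b. exp (k b * ln r)) (P' X)"
  proof -
    have "(\<lambda>n. \<Sum>b\<in>Basis. ((k b * ln r) ^ n /\<^sub>R fact n * (P' X \<bullet> b)) *\<^sub>R b)
        sums (\<Sum>b\<in>Basis. (exp (k b * ln r) * (P' X \<bullet> b)) *\<^sub>R b)"
      by (intro sums_sum bounded_linear.sums[OF bounded_linear_scaleR_left]
          bounded_linear.sums[OF bounded_linear_mult_left] exp_converges)
    then show ?thesis
      by (simp add: diag_map_def scaleR_sum_right divide_inverse mult_ac)
  qed
  from bounded_linear.sums[OF _ this, of P] show ?thesis
    unfolding alg_dilation_def pow using assms(1)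
    by (simp add: linear_cmul linear_conv_bounded_linear sums_unique[symmetric])
qed

lemma continuous_on_linear: "linear f \<Longrightarrow> continuous_on S f"
  for f :: "'b::euclidean_space \<Rightarrow> 'c::real_normed_vector"
  by (simp add: linear_continuous_on linear_conv_bounded_linear)

locale dilations =
  fixes A P P' :: "'a::euclidean_space \<Rightarrow> 'a" and k :: "'a \<Rightarrow> real"
  assumes P: "linear P" "linear P'" "\<And>x. P' (P x) = x" "\<And>x. P (P' x) = x"
    and A_eq: "A = P \<circ> diag_map k \<circ> P'"
    and k_pos: "\<And>b. b \<in> Basis \<Longrightarrow> k b > 0"
begin

abbreviation "\<delta> \<equiv> alg_dilation A"

lemma delta_eq: "\<delta> r p = P (diag_map (\<lambda>b. exp (k b * ln r)) (P' p))"
  unfolding A_eq by (rule alg_dilation_conj_diag_map) (fact P)+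

lemma delta_eq_sum: "\<delta> r p = (\<Sum>b\<in>Basis. (exp (k b * ln r) * (P' p \<bullet> b)) *\<^sub>R P b)"
  by (simp add: delta_eq diag_map_def linear_sum[OF P(1)] linear_cmul[OF P(1)])

lemma delta_delta: "r > 0 \<Longrightarrow> s > 0 \<Longrightarrow> \<delta> r (\<delta> s p) = \<delta> (r * s) p"
  by (simp add: delta_eq P diag_map_compose ln_mult exp_add distrib_left)

lemma delta_one: "\<delta> 1 p = p"
  by (simp add: delta_eq diag_map_one P)

lemma linear_delta: "linear (\<delta> r)"
proof -
  have "linear (P \<circ> diag_map (\<lambda>b. exp (k b * ln r)) \<circ> P')"
    by (intro linear_compose P linear_diag_map)
  then show ?thesis by (simp add: o_def delta_eq[abs_def])
qed

lemma linear_A: "linear A"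
  unfolding A_eq by (intro linear_compose P linear_diag_map)

lemma bij_delta: "r > 0 \<Longrightarrow> bij (\<delta> r)"
  by (rule bij_betw_byWitness[where f' = "\<delta> (1 / r)"]) (auto simp: delta_delta delta_one)

text \<open>The determinant is the product of the factors \<open>r powr k b\<close>. The exponents
  add up to the trace of \<open>A\<close>, which is how the homogeneous dimension enters the scaling
  of measure.\<close>

lemma edet_delta:
  assumes "r > 0"
  shows "edet (\<delta> r) = r powr lin_trace A"
proof -
  have "\<delta> r = P \<circ> diag_map (\<lambda>b. exp (k b * ln r)) \<circ> P'"
    by (auto simp: delta_eq)
  then have "edet (\<delta> r) = (\<Prod>b\<in>Basis. exp (k b * ln r))"
    using edet_conj[OF P(1,2) linear_diag_map P(4)] by (simp add: edet_diag_map)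
  also have "\<dots> = r powr (\<Sum>b\<in>Basis. k b)"
    using assms by (simp add: powr_def exp_sum sum_distrib_right)
  also have "(\<Sum>b\<in>Basis. k b) = lin_trace A"
    unfolding A_eq using lin_trace_conj[OF P(1,2) linear_diag_map P(3)] by (simp add: lin_trace_diag_map)
  finally show ?thesis .
qed

lemma delta_tendsto_0: "((\<lambda>r. \<delta> r p) \<longlongrightarrow> 0) (at_right 0)"
proof -
  have "((\<lambda>r. exp (k b * ln r)) \<longlongrightarrow> 0) (at_right 0)" if "b \<in> Basis" for b
  proof -
    have "filterlim (\<lambda>r. k b * ln r) at_bot (at_right 0)"
      using ln_at_0 k_pos[OF that] by (rule filterlim_tendsto_pos_mult_at_bot[OF tendsto_const, rotated])
    then show ?thesis by (rule filterlim_compose[OF exp_at_bot])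
  qed
  then have "((\<lambda>r. \<delta> r p) \<longlongrightarrow> (\<Sum>b\<in>Basis. (0 * (P' p \<bullet> b)) *\<^sub>R P b)) (at_right 0)"
    unfolding delta_eq_sum by (intro tendsto_intros)
  then show ?thesis by simp
qed

lemma continuous_on_delta:
  assumes "continuous_on S f" "continuous_on S g" "\<And>x. x \<in> S \<Longrightarrow> f x > 0"
  shows "continuous_on S (\<lambda>x. \<delta> (f x) (g x))"
proof -
  have "\<forall>x\<in>S. f x \<noteq> 0" using assms(3) by force
  then show ?thesis
    unfolding delta_eq_sum using assms(1,2)
    by (intro continuous_intros continuous_on_compose2[OF continuous_on_linear[OF P(2), of UNIV]])
      auto
qed

text \<open>Each coordinate is a power of \<open>r\<close> in the eigenbasis. Consequently
  \<open>x \<mapsto> A x\<close> is the Euler field that generates the dilations, and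
  \<open>g' x (A x)\<close> is the Euler derivative of \<open>g\<close>.\<close>

lemma has_vector_derivative_delta:
  assumes "r > 0"
  shows "((\<lambda>r. \<delta> r p) has_vector_derivative (1 / r) *\<^sub>R A (\<delta> r p)) (at r)"
proof -
  have "((\<lambda>r. \<delta> r p) has_vector_derivative
      (\<Sum>b\<in>Basis. ((exp (k b * ln r) * (k b / r)) * (P' p \<bullet> b)) *\<^sub>R P b)) (at r)"
    unfolding delta_eq_sum
  proof (rule has_vector_derivative_sum)
    fix b
    have "((\<lambda>r. exp (k b * ln r) * (P' p \<bullet> b)) has_real_derivative
        exp (k b * ln r) * (k b / r) * (P' p \<bullet> b)) (at r)"
      using assms by (auto intro!: derivative_eq_intros)
    from has_vector_derivative_scaleR[OF this has_vector_derivative_const]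
    show "((\<lambda>r. (exp (k b * ln r) * (P' p \<bullet> b)) *\<^sub>R P b) has_vector_derivative
        (exp (k b * ln r) * (k b / r) * (P' p \<bullet> b)) *\<^sub>R P b) (at r)"
      by simp
  qed
  moreover have "A (\<delta> r p) = (\<Sum>b\<in>Basis. (k b * (exp (k b * ln r) * (P' p \<bullet> b))) *\<^sub>R P b)"
  proof -
    have "A q = P (diag_map k (P' q))" for q by (simp add: A_eq)
    then have "A (\<delta> r p) = P (diag_map (\<lambda>b. k b * exp (k b * ln r)) (P' p))"
      by (simp add: delta_eq P diag_map_compose)
    then show ?thesis
      by (simp add: diag_map_def linear_sum[OF P(1)] linear_cmul[OF P(1)] mult.assoc)
  qed
  ultimately show ?thesis
    by (simp add: scaleR_sum_right mult_ac)
qed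

end

section \<open>Integrals weighted by powers of a quasi-norm\<close>

lemma integrable_lborel_compact_support:
  fixes F :: "'a::euclidean_space \<Rightarrow> 'b::euclidean_space"
  assumes "continuous_on UNIV F" "\<And>x. x \<notin> cbox a b \<Longrightarrow> F x = 0"
  shows "integrable lborel F" and "(\<integral>x. F x \<partial>lborel) = integral (cbox a b) F"
proof -
  have "set_integrable lborel (cbox a b) F"
    unfolding set_integrable_def
    using assms(1) borel_integrable_compact[OF compact_cbox] continuous_on_subset by blast
  moreover have F: "(\<lambda>x. indicator (cbox a b) x *\<^sub>R F x) = F"
    using assms(2) by (auto simp: indicator_def)
  ultimately show "integrable lborel F" "(\<integral>x. F x \<partial>lborel) = integral (cbox a b) F"
    using set_borel_integral_eq_integral(2)[of "cbox a b" F]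
    by (simp_all add: set_integrable_def set_lebesgue_integral_def F)
qed

locale quasi_norm = dilations +
  fixes N :: "'a \<Rightarrow> real"
  assumes N_cont: "continuous_on UNIV N" and N_nonneg: "N x \<ge> 0"
    and N_delta: "r > 0 \<Longrightarrow> N (\<delta> r x) = r * N x"
    and N_eq_0: "N x = 0 \<longleftrightarrow> x = 0"
begin

text \<open>A support away from the identity keeps the quasi-norm away from \<open>0\<close>, so its
  negative powers can be replaced there by continuous weights.\<close>

lemma N_bounded_below:
  assumes "compact K" "0 \<notin> K"
  obtains \<epsilon> where "\<epsilon> > 0" "\<And>x. x \<in> K \<Longrightarrow> N x \<ge> \<epsilon>"
proof (cases "K = {}")
  case False
  then obtain x where "x \<in> K" "\<And>y. y \<in> K \<Longrightarrow> N x \<le> N y"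
    using continuous_attains_inf[OF assms(1)] N_cont continuous_on_subset by (metis subset_UNIV)
  moreover from this have "N x > 0"
    using N_nonneg[of x] N_eq_0[of x] assms(2) by (metis order_le_less)
  ultimately show ?thesis using that by blast
qed (use that[of 1] in auto)

text \<open>The derivative at \<open>r = 1\<close> of the integral of
  \<open>N x powr s * g (\<delta> r x)\<close> is computed twice. Substituting the dilation shows
  that the integral is a multiple of \<open>r powr (- (s + lin_trace A))\<close>; differentiating
  under the integral gives the Euler derivative of \<open>g\<close>.\<close>

lemma integral_euler:
  fixes g :: "'a \<Rightarrow> real"
  assumes K: "compact K" "0 \<notin> K" "\<And>x. x \<notin> K \<Longrightarrow> g x = 0"
    and g: "\<And>x. (g has_derivative g' x) (at x)"
    and g'_cont: "continuous_on UNIV (\<lambda>x. g' x (A x))"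
  shows "(\<integral>x. N x powr s * g' x (A x) \<partial>lborel)
    = - (s + lin_trace A) * (\<integral>x. N x powr s * g x \<partial>lborel)"
proof -
  obtain \<epsilon> where \<epsilon>: "\<epsilon> > 0" "\<And>x. x \<in> K \<Longrightarrow> N x \<ge> \<epsilon>"
    using N_bounded_below[OF K(1,2)] by blast
  \<comment> \<open>The truncated weight is continuous even at the identity. The threshold is
    \<open>\<epsilon> / 2\<close> because \<open>\<delta> r x \<in> K\<close> with
    \<open>r < 2\<close> only gives \<open>N x \<ge> \<epsilon> / 2\<close>.\<close>
  define w where "w x = (max (N x) (\<epsilon> / 2)) powr s" for x
  define U where "U = {1/2 <..< 2 :: real}"
  have [continuous_intros]: "continuous_on S (\<lambda>x. w (f x))" if "continuous_on S f" for S and f :: "'b::topological_space \<Rightarrow> 'a"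
    unfolding w_def using \<epsilon>(1)
    by (intro continuous_intros continuous_on_compose2[OF N_cont that]) (auto simp: max_def)
  have g_cont: "continuous_on UNIV g"
    using g has_derivative_continuous by (metis continuous_on_eq_continuous_within)
  have g'_0: "g' x v = 0" if "x \<notin> K" for x v
  proof -
    have "open (- K)" using K(1) by (simp add: compact_imp_closed open_Compl)
    then have "(g has_derivative (\<lambda>_. 0)) (at x)"
      using has_derivative_transform_within_open[of "\<lambda>_. 0" "\<lambda>_. 0" x UNIV "- K" g] K(3) that by auto
    then show ?thesis using has_derivative_unique[OF g] by metis
  qed
  have w: "N x powr s * h (\<delta> r x) = w x * h (\<delta> r x)"
    if "r \<in> U" "\<And>x. x \<notin> K \<Longrightarrow> h x = 0" for r x and h :: "'a \<Rightarrow> real"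
  proof (cases "\<delta> r x \<in> K")
    case True
    then have "\<epsilon> \<le> N (\<delta> r x)" by (rule \<epsilon>(2))
    also have "\<dots> = r * N x"
      using that(1) by (intro N_delta) (simp add: U_def)
    also have "\<dots> \<le> 2 * N x"
      using that(1) N_nonneg by (intro mult_right_mono) (auto simp: U_def)
    finally have "max (N x) (\<epsilon> / 2) = N x" by simp
    then show ?thesis by (simp add: w_def)
  qed (simp add: that)
  \<comment> \<open>For \<open>r\<close> in \<open>U\<close> every point with
    \<open>\<delta> r x \<in> K\<close> lies in this compact set, since \<open>1 / r\<close> stays
    in \<open>{1/2..2}\<close>. Thus a single box serves all \<open>r\<close>, as differentiation
    under the integral requires.\<close>
  define K2 where "K2 = (\<lambda>(r, x). \<delta> r x) ` ({1/2..2} \<times> K)"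
  have "compact K2"
    unfolding K2_def case_prod_beta
    by (intro compact_continuous_image continuous_on_delta continuous_intros compact_Times K) auto
  then obtain a where a: "K2 \<subseteq> cbox (- a) a"
    using bounded_subset_cbox_symmetric compact_imp_bounded by blast
  have supp: "h (\<delta> r x) = 0"
    if "r \<in> U" "x \<notin> cbox (- a) a" "\<And>x. x \<notin> K \<Longrightarrow> h x = 0" for r x and h :: "'a \<Rightarrow> real"
  proof (rule that(3), rule notI)
    assume "\<delta> r x \<in> K"
    moreover have "1 / r \<in> {1/2..2}" using that(1) by (auto simp: U_def field_simps)
    ultimately have "\<delta> (1 / r) (\<delta> r x) \<in> K2" unfolding K2_def by auto
    then show False
      using that(1,2) a by (auto simp: U_def delta_delta delta_one)
  qed
  define I where "I = (\<integral>x. N x powr s * g x \<partial>lborel)"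
  define \<Phi> where "\<Phi> r = integral (cbox (- a) a) (\<lambda>x. w x * g (\<delta> r x))" for r
  have U1: "1 \<in> U" by (simp add: U_def)
  have cont_r: "continuous_on UNIV (\<lambda>x. w x * h (\<delta> r x))"
    if "r \<in> U" "continuous_on UNIV h" for r and h :: "'a \<Rightarrow> real"
    using that(1)
    by (intro continuous_intros continuous_on_compose2[OF that(2)] continuous_on_delta) (auto simp: U_def)
  \<comment> \<open>Substituting the dilation in \<open>I\<close> gives the Jacobian
    \<open>r powr lin_trace A\<close> and, by homogeneity of the quasi-norm, the factor
    \<open>r powr s\<close>.\<close>
  have "\<Phi> r = r powr (- (s + lin_trace A)) * I" if "r \<in> U" for r
  proof -
    have "r > 0" using that by (simp add: U_def)
    define h where "h x = w x * g x" for x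
    have "N x powr s * g x = w x * g x" for x
      using w[OF U1, of g x] K(3) by (simp add: delta_one)
    then have "I = (\<integral>x. h x \<partial>lborel)"
      by (simp only: I_def h_def)
    also have "\<dots> = edet (\<delta> r) *\<^sub>R (\<integral>x. h (\<delta> r x) \<partial>lborel)"
    proof (rule integral_lborel_linear[OF linear_delta bij_delta])
      show "h \<in> borel_measurable borel"
        unfolding h_def using g_cont by (intro borel_measurable_continuous_onI continuous_intros)
    qed (use \<open>r > 0\<close> edet_delta in auto)
    also have "(\<lambda>x. h (\<delta> r x)) = (\<lambda>x. r powr s * (w x * g (\<delta> r x)))"
    proof
      fix x
      have "w (\<delta> r x) * g (\<delta> r x) = N (\<delta> r x) powr s * g (\<delta> r x)"
        using w[OF U1, of g "\<delta> r x"] K(3) by (auto simp: delta_one)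
      also have "\<dots> = r powr s * (N x powr s * g (\<delta> r x))"
        using \<open>r > 0\<close> N_nonneg by (simp add: N_delta powr_mult)
      finally show "h (\<delta> r x) = r powr s * (w x * g (\<delta> r x))"
        using w[OF that, of g x] K(3) by (simp add: h_def)
    qed
    also have "(\<integral>x. r powr s * (w x * g (\<delta> r x)) \<partial>lborel) = r powr s * \<Phi> r"
      unfolding \<Phi>_def
      by (subst integrable_lborel_compact_support(2)[OF cont_r[OF that g_cont], symmetric])
        (simp_all add: supp[OF that, of _ g] K(3))
    finally show ?thesis
      using \<open>r > 0\<close> by (simp add: edet_delta powr_minus powr_add powr_diff field_simps)
  qed
  moreover have "((\<lambda>r. r powr (- (s + lin_trace A)) * I) has_real_derivative
      - (s + lin_trace A) * I) (at 1)"
    by (auto intro!: derivative_eq_intros)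
  ultimately have "(\<Phi> has_real_derivative - (s + lin_trace A) * I) (at 1)"
    using U1 has_field_derivative_transform_within_open[of "\<lambda>r. r powr (- (s + lin_trace A)) * I" _ 1 U \<Phi>]
    by (simp add: U_def)
  \<comment> \<open>The derivative of \<open>g (\<delta> r x)\<close> in \<open>r\<close> is the
    Euler derivative divided by \<open>r\<close>; the denominator \<open>1\<close> is its value at
    \<open>r = 1\<close>.\<close>
  moreover have "(\<Phi> has_real_derivative
      integral (cbox (- a) a) (\<lambda>x. w x * g' (\<delta> 1 x) (A (\<delta> 1 x)) / 1)) (at 1 within U)"
    unfolding \<Phi>_def
  proof (rule leibniz_rule_field_derivative)
    fix r x assume "r \<in> U"
    then have "r > 0" by (simp add: U_def)
    have "(g \<circ> (\<lambda>r. \<delta> r x) has_derivative g' (\<delta> r x) \<circ> (\<lambda>h. h *\<^sub>R (1 / r) *\<^sub>R A (\<delta> r x))) (at r)"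
      by (rule diff_chain_at)
        (use has_vector_derivative_delta[OF \<open>r > 0\<close>] g in \<open>auto simp: has_vector_derivative_def\<close>)
    then have "((\<lambda>r. g (\<delta> r x)) has_real_derivative g' (\<delta> r x) (A (\<delta> r x)) / r) (at r)"
      unfolding has_field_derivative_def o_def
      by (rule has_derivative_eq_rhs)
        (simp add: linear_cmul[OF has_derivative_linear[OF g]] fun_eq_iff)
    from DERIV_cmult[OF this, of "w x"]
    show "((\<lambda>r. w x * g (\<delta> r x)) has_real_derivative w x * g' (\<delta> r x) (A (\<delta> r x)) / r) (at r within U)"
      by (simp add: has_field_derivative_at_within)
  next
    show "(\<lambda>x. w x * g (\<delta> r x)) integrable_on cbox (- a) a" if "r \<in> U" for r
      using cont_r[OF that g_cont] continuous_on_subset by (intro integrable_continuous) blast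
    show "continuous_on (U \<times> cbox (- a) a) (\<lambda>(r, x). w x * g' (\<delta> r x) (A (\<delta> r x)) / r)"
      unfolding case_prod_beta
      by (intro continuous_intros continuous_on_compose2[OF g'_cont] continuous_on_delta)
        (auto simp: U_def)
  qed (auto simp: U_def)
  ultimately have "integral (cbox (- a) a) (\<lambda>x. w x * g' (\<delta> 1 x) (A (\<delta> 1 x)) / 1)
      = - (s + lin_trace A) * I"
    using U1 DERIV_unique at_within_open[of 1 U] by (metis U_def open_greaterThanLessThan)
  moreover have "(\<integral>x. w x * g' x (A x) \<partial>lborel) = integral (cbox (- a) a) (\<lambda>x. w x * g' x (A x))"
    using cont_r[OF U1 g'_cont] supp[OF U1, of _ "\<lambda>x. g' x (A x)"] g'_0
    by (intro integrable_lborel_compact_support) (auto simp: delta_one)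
  moreover have "N x powr s * g' x (A x) = w x * g' x (A x)" for x
    using w[OF U1, of "\<lambda>x. g' x (A x)" x] g'_0 by (simp add: delta_one)
  ultimately show ?thesis
    by (simp only: delta_one I_def div_by_1)
qed

text \<open>\<open>U\<close> and \<open>V\<close> stand for the weighted radial derivative and the
  weighted function. By \<open>integral_euler\<close> the integral of
  \<open>2 * (U x \<bullet> V x)\<close> is \<open>- 2 * c\<close> times that of the squared modulus
  of \<open>V\<close>, so expanding the square of \<open>U + c V\<close> leaves that of
  \<open>U\<close> minus \<open>c\<^sup>2\<close> times that of \<open>V\<close>.\<close>

lemma hardy_identity:
  fixes f :: "'a \<Rightarrow> complex" and \<alpha> c :: real
  assumes f: "smooth_on UNIV f" and K: "compact K" "0 \<notin> K" "{x. f x \<noteq> 0} \<subseteq> K"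
    and c: "c = (lin_trace A - 2) / 2 - \<alpha>"
  defines "U \<equiv> \<lambda>x. of_real (N x powr (- \<alpha> - 1)) * frechet_derivative f (at x) (A x)"
    and "V \<equiv> \<lambda>x. of_real (N x powr (- \<alpha> - 1)) * f x"
  shows "U \<in> borel_measurable borel" "V \<in> borel_measurable borel"
    "integrable lborel (\<lambda>x. (cmod (U x))\<^sup>2)" "integrable lborel (\<lambda>x. (cmod (V x))\<^sup>2)"
    "integrable lborel (\<lambda>x. (cmod (U x + c *\<^sub>R V x))\<^sup>2)"
    "(\<integral>x. (cmod (U x))\<^sup>2 \<partial>lborel)
      = c\<^sup>2 * (\<integral>x. (cmod (V x))\<^sup>2 \<partial>lborel) + (\<integral>x. (cmod (U x + c *\<^sub>R V x))\<^sup>2 \<partial>lborel)"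
proof -
  have f_0: "f x = 0" if "x \<notin> K" for x
    using K(3) that by blast
  let ?f' = "\<lambda>x. frechet_derivative f (at x)"
  have f': "(f has_derivative ?f' x) (at x)" for x
    using smooth_on_has_derivative[OF f] by simp
  have f'_0: "?f' x v = 0" if "x \<notin> K" for x v
  proof -
    have "open (- K)" using K(1) by (simp add: compact_imp_closed open_Compl)
    then have "(f has_derivative (\<lambda>_. 0)) (at x)"
      using has_derivative_transform_within_open[of "\<lambda>_. 0" "\<lambda>_. 0" x UNIV "- K" f] f_0 that by auto
    then show ?thesis using has_derivative_unique[OF f'] by metis
  qed
  obtain \<epsilon> where \<epsilon>: "\<epsilon> > 0" "\<And>x. x \<in> K \<Longrightarrow> N x \<ge> \<epsilon>"
    using N_bounded_below[OF K(1,2)] by blast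
  \<comment> \<open>On the support this agrees with the singular weight, and it is continuous
    everywhere, so \<open>U\<close> and \<open>V\<close> are continuous with compact
    support.\<close>
  define w where "w x = (max (N x) \<epsilon>) powr (- \<alpha> - 1)" for x
  have w_cont: "continuous_on UNIV w"
    unfolding w_def using \<epsilon>(1) by (intro continuous_intros N_cont) (auto simp: max_def)
  have w: "N x powr (- \<alpha> - 1) = w x" if "x \<in> K" for x
    using \<epsilon>(2)[OF that] by (simp add: w_def max_absorb1)
  have U_eq: "U = (\<lambda>x. of_real (w x) * ?f' x (A x))" and V_eq: "V = (\<lambda>x. of_real (w x) * f x)"
    using f'_0 f_0 w by (auto simp: U_def V_def fun_eq_iff)
  have f_cont: "continuous_on UNIV f" and f'_cont: "continuous_on UNIV (\<lambda>x. ?f' x v)" for v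
    using smooth_on_imp_continuous_on f smooth_on_frechet_derivative by blast+
  have A_cont: "continuous_on UNIV (\<lambda>x. ?f' x (A x))"
  proof -
    have "?f' x (A x) = (\<Sum>b\<in>Basis. (A x \<bullet> b) *\<^sub>R ?f' x b)" for x
      by (rule linear_euclidean_expansion[OF has_derivative_linear[OF f']])
    then show ?thesis
      using continuous_on_linear[OF linear_A] by (simp only:) (intro continuous_intros f'_cont)
  qed
  have U_cont: "continuous_on UNIV U" and V_cont: "continuous_on UNIV V"
    unfolding U_eq V_eq by (intro continuous_intros w_cont A_cont f_cont)+
  then show "U \<in> borel_measurable borel" "V \<in> borel_measurable borel"
    by (auto intro: borel_measurable_continuous_onI)
  obtain a where a: "K \<subseteq> cbox (- a) a"
    using bounded_subset_cbox_symmetric compact_imp_bounded K(1) by blast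
  have supp: "U x = 0" "V x = 0" if "x \<notin> cbox (- a) a" for x
    using a that f'_0 f_0 by (auto simp: U_def V_def)
  have int: "integrable lborel (\<lambda>x. (cmod (r *\<^sub>R U x + s *\<^sub>R V x))\<^sup>2)" for r s
    by (rule integrable_lborel_compact_support[of _ "- a" a])
      (auto intro!: continuous_intros U_cont V_cont simp: supp)
  show intU: "integrable lborel (\<lambda>x. (cmod (U x))\<^sup>2)" and intV: "integrable lborel (\<lambda>x. (cmod (V x))\<^sup>2)"
    and "integrable lborel (\<lambda>x. (cmod (U x + c *\<^sub>R V x))\<^sup>2)"
    using int[of 1 0] int[of 0 1] int[of 1 c] by simp_all
  have inner: "integrable lborel (\<lambda>x. 2 * (U x \<bullet> V x))"
    by (rule integrable_lborel_compact_support[of _ "- a" a])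
      (auto intro!: continuous_intros U_cont V_cont simp: supp)
  \<comment> \<open>The Euler identity is applied to the squared modulus of \<open>f\<close>,
    written as an inner product, with \<open>s = - 2 * \<alpha> - 2\<close>; then
    \<open>s + lin_trace A = 2 * c\<close>.\<close>
  have "(\<integral>x. N x powr (- 2 * \<alpha> - 2) * (f x \<bullet> ?f' x (A x) + ?f' x (A x) \<bullet> f x) \<partial>lborel)
      = - (- 2 * \<alpha> - 2 + lin_trace A) * (\<integral>x. N x powr (- 2 * \<alpha> - 2) * (f x \<bullet> f x) \<partial>lborel)"
  proof (rule integral_euler[OF K(1,2)])
    show "((\<lambda>x. f x \<bullet> f x) has_derivative (\<lambda>v. f x \<bullet> ?f' x v + ?f' x v \<bullet> f x)) (at x)" for x
      by (rule has_derivative_inner[OF f' f'])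
    show "continuous_on UNIV (\<lambda>x. f x \<bullet> ?f' x (A x) + ?f' x (A x) \<bullet> f x)"
      by (intro continuous_intros f_cont A_cont)
  qed (simp add: f_0)
  moreover have "N x powr (- 2 * \<alpha> - 2) = N x powr (- \<alpha> - 1) * N x powr (- \<alpha> - 1)" for x
    by (simp flip: powr_add)
  then have "N x powr (- 2 * \<alpha> - 2) * (f x \<bullet> ?f' x (A x) + ?f' x (A x) \<bullet> f x) = 2 * (U x \<bullet> V x)"
    and "N x powr (- 2 * \<alpha> - 2) * (f x \<bullet> f x) = (cmod (V x))\<^sup>2" for x
    by (simp add: U_def V_def inner_commute flip: scaleR_conv_of_real,
        simp add: V_def dot_square_norm norm_mult power2_eq_square mult_ac)
  ultimately have cross: "(\<integral>x. 2 * (U x \<bullet> V x) \<partial>lborel) = - 2 * c * (\<integral>x. (cmod (V x))\<^sup>2 \<partial>lborel)"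
    by (simp add: c field_simps)
  have "(cmod (U x + c *\<^sub>R V x))\<^sup>2 = (cmod (U x))\<^sup>2 + c * (2 * (U x \<bullet> V x)) + c\<^sup>2 * (cmod (V x))\<^sup>2" for x
    unfolding power2_norm_eq_inner
    by (simp add: inner_add_left inner_add_right inner_commute power2_eq_square algebra_simps)
  then have "(\<integral>x. (cmod (U x + c *\<^sub>R V x))\<^sup>2 \<partial>lborel)
      = (\<integral>x. (cmod (U x))\<^sup>2 + c * (2 * (U x \<bullet> V x)) + c\<^sup>2 * (cmod (V x))\<^sup>2 \<partial>lborel)"
    by (simp only:)
  also have "\<dots> = (\<integral>x. (cmod (U x))\<^sup>2 \<partial>lborel) + c * (\<integral>x. 2 * (U x \<bullet> V x) \<partial>lborel)
      + c\<^sup>2 * (\<integral>x. (cmod (V x))\<^sup>2 \<partial>lborel)"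
    using intU intV inner
    by (simp only: Bochner_Integration.integral_add Bochner_Integration.integrable_add
        integrable_mult_right integral_mult_right_zero)
  finally show "(\<integral>x. (cmod (U x))\<^sup>2 \<partial>lborel)
      = c\<^sup>2 * (\<integral>x. (cmod (V x))\<^sup>2 \<partial>lborel) + (\<integral>x. (cmod (U x + c *\<^sub>R V x))\<^sup>2 \<partial>lborel)"
    using cross by (simp add: power2_eq_square)
qed

end

section \<open>Homogeneous groups in exponential coordinates\<close>

lemma smooth_atlas_chart_at:
  assumes "smooth_atlas \<A>"
  obtains U \<phi> where "(U, \<phi>) \<in> \<A>" "x \<in> U"
proof -
  have "x \<in> (\<Union>(U, \<phi>)\<in>\<A>. U)"
    using assms by (simp add: smooth_atlas_def)
  then obtain c where "c \<in> \<A>" "x \<in> fst c"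
    by (auto simp: case_prod_beta)
  then show thesis using that[of "fst c" "snd c"] by simp
qed

lemma smooth_atlas_chart:
  assumes "smooth_atlas \<A>" "(U, \<phi>) \<in> \<A>"
  shows "open U" "homeomorphism U (\<phi> ` U) \<phi> (inv_into U \<phi>)" "inj_on \<phi> U"
proof -
  show "open U" and hom: "homeomorphism U (\<phi> ` U) \<phi> (inv_into U \<phi>)"
    using bspec[OF conjunct1[OF assms(1)[unfolded smooth_atlas_def]] assms(2)] by simp_all
  show "inj_on \<phi> U"
    using homeomorphism_apply1[OF hom] by (rule inj_on_inverseI)
qed

lemma global_diffeo_chart:
  assumes "global_diffeo \<A> e" "(U, \<phi>) \<in> \<A>"
  shows "smooth_on (e -` U) (\<phi> \<circ> e)" "smooth_on (\<phi> ` U) (inv e \<circ> inv_into U \<phi>)"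
  using bspec[OF conjunct2[OF assms(1)[unfolded global_diffeo_def]] assms(2)] by simp_all

text \<open>The exponential map acts as one global chart: in each chart the transition to it is
  smooth in both directions. Smoothness on the group thus becomes smoothness on a vector
  space.\<close>

lemma smooth_fun_iff:
  fixes \<A> :: "('g::{t2_space, second_countable_topology, group_add}, 'm::euclidean_space) atlas"
    and e :: "'a::euclidean_space \<Rightarrow> 'g" and f :: "'g \<Rightarrow> 'b::real_normed_vector"
  assumes atlas: "smooth_atlas \<A>" and e: "global_diffeo \<A> e"
  shows "smooth_fun \<A> f \<longleftrightarrow> smooth_on UNIV (f \<circ> e)"
proof
  have "bij e" using e by (simp add: global_diffeo_def)
  show "smooth_on UNIV (f \<circ> e)" if f: "smooth_fun \<A> f"
  proof (rule smooth_on_local)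
    fix x
    obtain U \<phi> where U: "(U, \<phi>) \<in> \<A>" "e x \<in> U"
      by (rule smooth_atlas_chart_at[OF atlas])
    have "smooth_on (e -` U) (\<phi> \<circ> e)" "smooth_on (\<phi> ` U) (f \<circ> inv_into U \<phi>)"
      using global_diffeo_chart[OF e U(1)] f U(1) by (auto simp: smooth_fun_def)
    then have "smooth_on (e -` U) ((f \<circ> inv_into U \<phi>) \<circ> (\<phi> \<circ> e))"
      by (rule smooth_on_compose) auto
    then have "smooth_on (e -` U) (f \<circ> e)"
      by (rule smooth_on_cong) (simp add: smooth_atlas_chart(3)[OF atlas U(1)])
    with U(2) show "\<exists>T. x \<in> T \<and> smooth_on T (f \<circ> e)" by blast
  qed simp
  show "smooth_fun \<A> f" if f: "smooth_on UNIV (f \<circ> e)"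
    unfolding smooth_fun_def
  proof clarify
    fix U \<phi> assume U: "(U, \<phi>) \<in> \<A>"
    from smooth_on_compose[OF global_diffeo_chart(2)[OF e U] f] have "smooth_on (\<phi> ` U) ((f \<circ> e) \<circ> (inv e \<circ> inv_into U \<phi>))"
      by simp
    then show "smooth_on (\<phi> ` U) (f \<circ> inv_into U \<phi>)"
      by (rule smooth_on_cong) (simp add: surj_f_inv_f[OF bij_is_surj[OF \<open>bij e\<close>]])
  qed
qed

lemma continuous_on_global_diffeo:
  fixes \<A> :: "('g::{t2_space, second_countable_topology, group_add}, 'm::euclidean_space) atlas"
    and e :: "'a::euclidean_space \<Rightarrow> 'g"
  assumes atlas: "smooth_atlas \<A>" and e: "global_diffeo \<A> e"
  shows "continuous_on UNIV e" and "continuous_on UNIV (inv e)"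
proof -
  have "isCont e x \<and> isCont (inv e) (e x)" for x
  proof -
    obtain U \<phi> where U: "(U, \<phi>) \<in> \<A>" "e x \<in> U"
      by (rule smooth_atlas_chart_at[OF atlas])
    note hom = smooth_atlas_chart[OF atlas U(1)]
    note sm = global_diffeo_chart[OF e U(1)]
    have inv: "inv_into U \<phi> (\<phi> y) = y" if "y \<in> U" for y
      using homeomorphism_apply1[OF hom(2) that] .
    have "continuous_on (e -` U) (inv_into U \<phi> \<circ> (\<phi> \<circ> e))"
      using homeomorphism_cont2[OF hom(2)]
      by (intro continuous_on_compose smooth_on_imp_continuous_on[OF sm(1)])
        (auto elim: continuous_on_subset)
    then have "continuous_on (e -` U) e"
      by (rule continuous_on_eq) (simp add: inv)
    moreover have "open (e -` U)" using sm(1) by (simp add: smooth_on_def)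
    ultimately have "isCont e x" using U(2) by (simp add: continuous_on_eq_continuous_at)
    have "continuous_on U ((inv e \<circ> inv_into U \<phi>) \<circ> \<phi>)"
      by (intro continuous_on_compose smooth_on_imp_continuous_on[OF sm(2)]
          homeomorphism_cont1[OF hom(2)])
    then have "continuous_on U (inv e)"
      by (rule continuous_on_eq) (simp add: inv)
    with hom(1) U(2) \<open>isCont e x\<close> show ?thesis by (simp add: continuous_on_eq_continuous_at)
  qed
  moreover have "surj e" using e by (simp add: global_diffeo_def bij_is_surj)
  ultimately show "continuous_on UNIV e" "continuous_on UNIV (inv e)"
    by (metis continuous_at_imp_continuous_on, metis continuous_at_imp_continuous_on surjD)
qed

section \<open>The group law transported to the Lie algebra\<close>

definition exp_law :: "('a \<Rightarrow> 'g::group_add) \<Rightarrow> 'a \<Rightarrow> 'a \<Rightarrow> 'a" where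
  "exp_law e p q = inv e (e p + e q)"

text \<open>The transported product is the Baker-Campbell-Hausdorff law. Near a pair of points it is
  a composite of smooth maps: exponentials into charts, the product in charts, and the logarithm
  from a chart.\<close>

lemma smooth_exp_law:
  fixes \<A> :: "('g::{topological_group_add, t2_space, second_countable_topology}, 'm::euclidean_space) atlas"
    and e :: "'a::euclidean_space \<Rightarrow> 'g"
  assumes G: "lie_group \<A>" and e: "global_diffeo \<A> e"
  shows "smooth_on UNIV (\<lambda>z. exp_law e (fst z) (snd z))"
proof (rule smooth_on_local)
  fix z :: "'a \<times> 'a"
  have atlas: "smooth_atlas \<A>" using G by (simp add: lie_group_def)
  note e_cont = continuous_on_global_diffeo(1)[OF atlas e]
  obtain U \<phi> where U: "(U, \<phi>) \<in> \<A>" "e (fst z) \<in> U" by (rule smooth_atlas_chart_at[OF atlas])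
  obtain V \<psi> where V: "(V, \<psi>) \<in> \<A>" "e (snd z) \<in> V" by (rule smooth_atlas_chart_at[OF atlas])
  obtain W \<xi> where W: "(W, \<xi>) \<in> \<A>" "e (fst z) + e (snd z) \<in> W" by (rule smooth_atlas_chart_at[OF atlas])
  note opn = smooth_atlas_chart(1)[OF atlas U(1)] smooth_atlas_chart(1)[OF atlas V(1)]
    smooth_atlas_chart(1)[OF atlas W(1)]
  note inj = smooth_atlas_chart(3)[OF atlas U(1)] smooth_atlas_chart(3)[OF atlas V(1)]
    smooth_atlas_chart(3)[OF atlas W(1)]
  \<comment> \<open>The open set of pairs whose two factors and product stay in the three chosen
    charts.\<close>
  define S where "S = {z :: 'a \<times> 'a. e (fst z) \<in> U \<and> e (snd z) \<in> V \<and> e (fst z) + e (snd z) \<in> W}"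
  have fst_cont: "continuous_on UNIV (\<lambda>z :: 'a \<times> 'a. e (fst z))"
    and snd_cont: "continuous_on UNIV (\<lambda>z :: 'a \<times> 'a. e (snd z))"
    by (intro continuous_on_compose2[OF e_cont] continuous_intros; simp)+
  have "open S"
    unfolding S_def
    using open_vimage[OF opn(1) fst_cont] open_vimage[OF opn(2) snd_cont]
      open_vimage[OF opn(3) continuous_on_add[OF fst_cont snd_cont]]
    by (auto simp: vimage_def intro!: open_Collect_conj)
  define T where "T = {(u, v). u \<in> \<phi> ` U \<and> v \<in> \<psi> ` V \<and> inv_into U \<phi> u + inv_into V \<psi> v \<in> W}"
  have T: "smooth_on T (\<lambda>(u, v). \<xi> (inv_into U \<phi> u + inv_into V \<psi> v))"
    unfolding T_def using G U(1) V(1) W(1) unfolding lie_group_def by blast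
  note sm = global_diffeo_chart(1)[OF e U(1)] global_diffeo_chart(1)[OF e V(1)]
    global_diffeo_chart(2)[OF e W(1)]
  have "smooth_on S ((\<phi> \<circ> e) \<circ> fst)" "smooth_on S ((\<psi> \<circ> e) \<circ> snd)"
    using \<open>open S\<close>
    by (auto intro!: smooth_on_compose[OF smooth_on_bounded_linear[OF _ bounded_linear_fst] sm(1)]
        smooth_on_compose[OF smooth_on_bounded_linear[OF _ bounded_linear_snd] sm(2)] simp: S_def)
  then have "smooth_on S (\<lambda>z. (((\<phi> \<circ> e) \<circ> fst) z, ((\<psi> \<circ> e) \<circ> snd) z))"
    by (rule smooth_on_Pair)
  moreover have "(\<lambda>z. (((\<phi> \<circ> e) \<circ> fst) z, ((\<psi> \<circ> e) \<circ> snd) z)) ` S \<subseteq> T"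
    by (auto simp: S_def T_def inj)
  ultimately have "smooth_on S ((\<lambda>(u, v). \<xi> (inv_into U \<phi> u + inv_into V \<psi> v))
      \<circ> (\<lambda>z. (((\<phi> \<circ> e) \<circ> fst) z, ((\<psi> \<circ> e) \<circ> snd) z)))"
    by (rule smooth_on_compose[OF _ T])
  from smooth_on_compose[OF this sm(3)] have "smooth_on S ((inv e \<circ> inv_into W \<xi>) \<circ>
      ((\<lambda>(u, v). \<xi> (inv_into U \<phi> u + inv_into V \<psi> v))
      \<circ> (\<lambda>z. (((\<phi> \<circ> e) \<circ> fst) z, ((\<psi> \<circ> e) \<circ> snd) z))))"
    by (auto simp: S_def inj)
  then have "smooth_on S (\<lambda>z. exp_law e (fst z) (snd z))"
    by (rule smooth_on_cong) (simp add: S_def inj exp_law_def)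
  moreover have "z \<in> S" using U V W by (simp add: S_def)
  ultimately show "\<exists>T. z \<in> T \<and> smooth_on T (\<lambda>z. exp_law e (fst z) (snd z))" by blast
qed simp

section \<open>Left-invariant fields and Haar measure in exponential coordinates\<close>

locale hom_group =
  fixes \<A> :: "('g::{topological_group_add, t2_space, second_countable_topology},
               'm::euclidean_space) atlas"
    and L :: "'a::euclidean_space \<Rightarrow> ('g \<Rightarrow> real) \<Rightarrow> ('g \<Rightarrow> real)"
    and lexp :: "'a \<Rightarrow> 'g" and A :: "'a \<Rightarrow> 'a"
  assumes hom_group: "homogeneous_group \<A> L lexp A"
begin

lemma diffeo: "global_diffeo \<A> lexp" and lie: "lie_group \<A>" and atlas: "smooth_atlas \<A>"
  using hom_group by (simp_all add: homogeneous_group_def lie_group_def)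

lemma exp_inv [simp]: "lexp (inv lexp x) = x" and inv_exp [simp]: "inv lexp (lexp p) = p"
  using diffeo by (auto simp: global_diffeo_def surj_f_inv_f bij_is_surj inv_f_f bij_is_inj)

lemmas smooth_fun_eq = smooth_fun_iff[OF atlas diffeo]
lemmas cont_exp = continuous_on_global_diffeo(1)[OF atlas diffeo]
lemmas cont_inv = continuous_on_global_diffeo(2)[OF atlas diffeo]

lemma exp_add: "lexp ((s + t) *\<^sub>R X) = lexp (s *\<^sub>R X) + lexp (t *\<^sub>R X)"
  and exp_deriv: "smooth_fun \<A> f \<Longrightarrow> ((\<lambda>t. f (lexp (t *\<^sub>R X))) has_real_derivative L X f 0) (at 0)"
  using hom_group by (auto simp: homogeneous_group_def is_exponential_def)

lemma exp_zero: "lexp 0 = 0"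
  using exp_add[of 0 0 0] by (metis add.right_neutral add_left_cancel scale_zero_right)

abbreviation "m \<equiv> exp_law lexp"

lemma exp_m: "lexp (m p q) = lexp p + lexp q"
  by (simp add: exp_law_def)

sublocale exp_coords m
proof
  show "smooth_on UNIV (\<lambda>z. m (fst z) (snd z))" by (rule smooth_exp_law[OF lie diffeo])
  show "m (s *\<^sub>R X) (t *\<^sub>R X) = (s + t) *\<^sub>R X" for s t X
    by (simp add: exp_law_def flip: exp_add)
qed (simp_all add: exp_law_def add.assoc exp_zero)

lemma L_fields: "L X \<in> left_invariant_fields \<A>" and range_L: "range L = left_invariant_fields \<A>"
  using hom_group by (auto simp: homogeneous_group_def is_lie_algebra_def bij_betw_def)

lemma L_smooth: "smooth_fun \<A> f \<Longrightarrow> smooth_fun \<A> (L X f)"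
  and L_nonsmooth: "\<not> smooth_fun \<A> f \<Longrightarrow> L X f = (\<lambda>_. 0)"
  and L_linear: "smooth_fun \<A> f \<Longrightarrow> smooth_fun \<A> h
    \<Longrightarrow> L X (\<lambda>x. a * f x + b * h x) = (\<lambda>x. a * L X f x + b * L X h x)"
  and L_mult: "smooth_fun \<A> f \<Longrightarrow> smooth_fun \<A> h
    \<Longrightarrow> L X (\<lambda>x. f x * h x) = (\<lambda>x. L X f x * h x + f x * L X h x)"
  and L_translate: "smooth_fun \<A> f \<Longrightarrow> L X (\<lambda>x. f (g + x)) = (\<lambda>x. L X f (g + x))"
  using L_fields[of X] unfolding left_invariant_fields_def by blast+

lemma smooth_fun_mult: "smooth_fun \<A> f \<Longrightarrow> smooth_fun \<A> h \<Longrightarrow> smooth_fun \<A> (\<lambda>x. f x * h x :: real)"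
  using smooth_on_bilinear[OF bounded_bilinear_mult, of UNIV "f \<circ> lexp" "h \<circ> lexp"]
  by (simp add: smooth_fun_eq o_def)

lemma smooth_fun_linear:
  assumes "smooth_fun \<A> f" "smooth_fun \<A> h"
  shows "smooth_fun \<A> (\<lambda>x. a * f x + b * h x :: real)"
proof -
  have "smooth_on UNIV (\<lambda>p. a * (f \<circ> lexp) p + b * (h \<circ> lexp) p)"
    using assms
    by (intro smooth_on_add smooth_on_bilinear[OF bounded_bilinear_mult] smooth_on_const)
      (simp_all add: smooth_fun_eq o_def)
  then show ?thesis by (simp add: smooth_fun_eq o_def)
qed

text \<open>The exponential map describes a field only at the identity. Left invariance transports
  this to \<open>lexp p\<close>, where the field differentiates \<open>f\<close> along
  \<open>lexp p + lexp (t *\<^sub>R X)\<close>; the chain rule through \<open>m\<close> gives the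
  frame.\<close>

lemma L_eq:
  assumes "smooth_fun \<A> f"
  shows "L X f (lexp p) = frechet_derivative (f \<circ> lexp) (at p) (left_frame m p X)"
proof -
  have f: "smooth_on UNIV (f \<circ> lexp)" using assms by (simp add: smooth_fun_eq)
  have "smooth_on UNIV (\<lambda>q. (p, q))"
    by (intro smooth_on_Pair smooth_on_const smooth_on_bounded_linear bounded_linear_ident) auto
  from smooth_on_compose[OF this smooth_m] have "smooth_on UNIV (m p)"
    by (simp add: o_def)
  from smooth_on_compose[OF this f] have "smooth_fun \<A> (\<lambda>x. f (lexp p + x))"
    by (simp add: smooth_fun_eq o_def exp_m)
  from exp_deriv[OF this] have "((\<lambda>t. f (lexp p + lexp (t *\<^sub>R X))) has_real_derivative L X f (lexp p)) (at 0)"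
    by (simp add: L_translate[OF assms])
  moreover have "((\<lambda>t. f (lexp p + lexp (t *\<^sub>R X))) has_real_derivative
      frechet_derivative (f \<circ> lexp) (at p) (left_frame m p X)) (at 0)"
  proof -
    have D: "(f \<circ> lexp has_derivative frechet_derivative (f \<circ> lexp) (at p)) (at p)"
      by (rule smooth_on_has_derivative[OF f]) simp
    have "(m p \<circ> (\<lambda>t. t *\<^sub>R X) has_derivative left_frame m p \<circ> (\<lambda>t. t *\<^sub>R X)) (at (0::real))"
      by (rule diff_chain_at) (use has_derivative_m2[of p 0] in \<open>auto intro!: derivative_eq_intros\<close>)
    from diff_chain_at[OF this, of "f \<circ> lexp"] D
    have "((f \<circ> lexp) \<circ> (m p \<circ> (\<lambda>t. t *\<^sub>R X)) has_derivative
        frechet_derivative (f \<circ> lexp) (at p) \<circ> (left_frame m p \<circ> (\<lambda>t. t *\<^sub>R X))) (at (0::real))"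
      by (simp add: zero_right)
    moreover have "(f \<circ> lexp) \<circ> (m p \<circ> (\<lambda>t. t *\<^sub>R X)) = (\<lambda>t. f (lexp p + lexp (t *\<^sub>R X)))"
      by (simp add: fun_eq_iff exp_m)
    moreover have "frechet_derivative (f \<circ> lexp) (at p) \<circ> (left_frame m p \<circ> (\<lambda>t. t *\<^sub>R X))
        = (*) (frechet_derivative (f \<circ> lexp) (at p) (left_frame m p X))"
      by (simp add: fun_eq_iff linear_cmul[OF linear_partial2] linear_cmul[OF has_derivative_linear[OF D]])
    ultimately show ?thesis
      by (simp only: has_field_derivative_def)
  qed
  ultimately show ?thesis by (rule DERIV_unique)
qed

text \<open>The bracket is defined through \<open>inv L\<close>, so it has its intended meaning only
  once the commutator is known to be a left-invariant field. The clauses are checked in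
  turn.\<close>

lemma L_lie_bracket: "L (lie_bracket L X Y) = (\<lambda>f x. L X (L Y f) x - L Y (L X f) x)" (is "_ = ?V")
proof -
  have zero: "L X (\<lambda>_. 0) = (\<lambda>_. 0)" for X
  proof -
    have "smooth_fun \<A> (\<lambda>_. 0 :: real)" by (simp add: smooth_fun_eq o_def smooth_on_const)
    from L_linear[OF this this, of X 0 0] show ?thesis by simp
  qed
  have "?V \<in> left_invariant_fields \<A>"
    unfolding left_invariant_fields_def mem_Collect_eq
  proof (intro conjI allI impI; (elim conjE)?)
    show "smooth_fun \<A> (\<lambda>x. L X (L Y f) x - L Y (L X f) x)" if "smooth_fun \<A> f" for f
      using smooth_fun_linear[of "L X (L Y f)" "L Y (L X f)" 1 "-1"] that by (simp add: L_smooth)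
    show "(\<lambda>x. L X (L Y f) x - L Y (L X f) x) = (\<lambda>_. 0)" if "\<not> smooth_fun \<A> f" for f
      by (simp add: L_nonsmooth[OF that] zero)
    show "(\<lambda>x. L X (L Y (\<lambda>x. a * f x + b * h x)) x - L Y (L X (\<lambda>x. a * f x + b * h x)) x)
        = (\<lambda>x. a * (L X (L Y f) x - L Y (L X f) x) + b * (L X (L Y h) x - L Y (L X h) x))"
      if "smooth_fun \<A> f" "smooth_fun \<A> h" for f h a b
      by (simp add: L_linear L_smooth that algebra_simps)
    show "(\<lambda>x. L X (L Y (\<lambda>x. f x * h x)) x - L Y (L X (\<lambda>x. f x * h x)) x)
        = (\<lambda>x. (L X (L Y f) x - L Y (L X f) x) * h x + f x * (L X (L Y h) x - L Y (L X h) x))"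
      if "smooth_fun \<A> f" "smooth_fun \<A> h" for f h
    proof -
      \<comment> \<open>The mixed first-order products are symmetric in \<open>X\<close> and
        \<open>Y\<close>, so they cancel in the commutator.\<close>
      have "L X (\<lambda>x. L Y f x * h x + f x * L Y h x)
          = (\<lambda>x. L X (L Y f) x * h x + L Y f x * L X h x + (L X f x * L Y h x + f x * L X (L Y h) x))" for X Y
        using L_linear[of "\<lambda>x. L Y f x * h x" "\<lambda>x. f x * L Y h x" X 1 1] that
        by (simp add: smooth_fun_mult L_smooth L_mult)
      then show ?thesis by (simp add: L_mult that algebra_simps)
    qed
    show "(\<lambda>x. L X (L Y (\<lambda>x. f (g + x))) x - L Y (L X (\<lambda>x. f (g + x))) x)
        = (\<lambda>x. L X (L Y f) (g + x) - L Y (L X f) (g + x))" if "smooth_fun \<A> f" for f g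
      by (simp add: L_translate L_smooth that)
  qed
  then show ?thesis
    unfolding lie_bracket_def using range_L by (intro f_inv_into_f) simp
qed

sublocale exp_group m "lie_bracket L"
proof
  fix X Y p
  show "frechet_derivative (\<lambda>p. left_frame m p Y) (at p) (left_frame m p X)
      - frechet_derivative (\<lambda>p. left_frame m p X) (at p) (left_frame m p Y)
      = left_frame m p (lie_bracket L X Y)" (is "?l = ?r")
  proof (rule euclidean_eqI)
    fix b :: 'a
    \<comment> \<open>Testing fields on the coordinate functions of the logarithm reads off the
      components of the frame, and the operator commutator becomes the commutator of frame
      derivatives.\<close>
    define f where "f x = inv lexp x \<bullet> b" for x
    have f_eq: "f \<circ> lexp = (\<lambda>p. p \<bullet> b)" by (simp add: f_def o_def)
    have f: "smooth_fun \<A> f"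
      by (simp add: smooth_fun_eq f_eq smooth_on_bounded_linear bounded_linear_inner_left)
    have "frechet_derivative (\<lambda>p. p \<bullet> b) (at p) = (\<lambda>v. v \<bullet> b)" for p :: 'a
      by (rule frechet_derivative_at[symmetric]) (auto intro!: derivative_eq_intros)
    then have Lf: "L Z f (lexp p) = left_frame m p Z \<bullet> b" for Z p
      by (simp add: L_eq[OF f] f_eq)
    have "L X (L Y f) (lexp p) = frechet_derivative (\<lambda>p. left_frame m p Y) (at p) (left_frame m p X) \<bullet> b"
      for X Y
    proof -
      have "L Y f \<circ> lexp = (\<lambda>p. left_frame m p Y \<bullet> b)" by (auto simp: Lf)
      moreover have "((\<lambda>p. left_frame m p Y \<bullet> b) has_derivative
          (\<lambda>v. frechet_derivative (\<lambda>p. left_frame m p Y) (at p) v \<bullet> b)) (at p)"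
        by (intro has_derivative_inner_left smooth_on_has_derivative[OF smooth_M]) simp
      ultimately show ?thesis
        by (simp add: L_eq[OF L_smooth[OF f]] flip: frechet_derivative_at)
    qed
    then show "?l \<bullet> b = ?r \<bullet> b"
      using fun_cong[OF fun_cong[OF L_lie_bracket], of X Y f "lexp p"] by (simp add: Lf inner_diff_left)
  qed
qed

lemma dilation_exp: "dilation lexp A r (lexp p) = lexp (alg_dilation A r p)"
  by (simp add: dilation_def)

lemma dilations_exist:
  obtains P P' :: "'a \<Rightarrow> 'a" and k where "dilations A P P' k"
proof -
  have "diagonalisable A" and pos: "\<And>c X. X \<noteq> 0 \<Longrightarrow> A X = c *\<^sub>R X \<Longrightarrow> c > 0"
    using hom_group by (auto simp: homogeneous_group_def)
  from diagonalisable_imp_conj_diag_map[OF this(1)] obtain P P' :: "'a \<Rightarrow> 'a" and k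
    where P: "linear P" "linear P'" "\<And>x. P' (P x) = x" "\<And>x. P (P' x) = x"
      and A: "A = P \<circ> diag_map k \<circ> P'" by blast
  have "k b > 0" if "b \<in> Basis" for b
  proof (rule pos)
    show "A (P b) = k b *\<^sub>R P b"
      using that by (simp add: A P diag_map_Basis linear_cmul)
    show "P b \<noteq> 0"
      using P(3)[of b] linear_0[OF P(2)] that by force
  qed
  with P A have "dilations A P P' k" by (intro dilations.intro)
  then show thesis by (rule that)
qed

sublocale unimodular_exp_group m "lie_bracket L"
proof
  fix p
  obtain P P' :: "'a \<Rightarrow> 'a" and k where "dilations A P P' k" by (rule dilations_exist)
  then interpret dilations A P P' k .
  show "edet (S p) = 1"
  proof (rule edet_S)
    show "alg_dilation A r (lie_bracket L X Y)
        = lie_bracket L (alg_dilation A r X) (alg_dilation A r Y)" if "r > 0" for r X Y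
      using hom_group that by (simp add: homogeneous_group_def)
  qed (use linear_delta edet_delta delta_tendsto_0 in auto)
qed

text \<open>The logarithm intertwines group translations with \<open>m\<close>, so the image of Haar
  measure under it is left-invariant for \<open>m\<close> and finite on compact sets. Hence it is a
  multiple of Lebesgue measure, and the exponential carries it back.\<close>

lemma haar_measure_pullback:
  assumes \<mu>: "haar_measure \<mu>"
  obtains \<kappa> where "\<kappa> \<ge> 0" "\<mu> = distr (density lborel (\<lambda>_. ennreal \<kappa>)) borel lexp"
proof -
  have sets [simp, measurable_cong]: "sets \<mu> = sets borel"
    and inv: "\<And>g. distr \<mu> borel (\<lambda>x. g + x) = \<mu>"
    and fin: "\<And>K. compact K \<Longrightarrow> emeasure \<mu> K < \<infinity>"
    using \<mu> by (auto simp: haar_measure_def)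
  have space: "space \<mu> = UNIV"
    using sets_eq_imp_space_eq[OF sets] by simp
  have [measurable]: "lexp \<in> borel_measurable borel" "inv lexp \<in> borel_measurable borel"
    "(+) g \<in> borel_measurable borel" for g :: 'g
    by (intro borel_measurable_continuous_onI cont_exp cont_inv continuous_intros)+
  define \<nu> where "\<nu> = distr \<mu> borel (inv lexp)"
  have "\<exists>\<kappa>\<ge>0. \<nu> = density lborel (\<lambda>_. ennreal \<kappa>)"
  proof (rule left_invariant_measure_eq)
    show "sets \<nu> = sets borel" by (simp add: \<nu>_def)
    show "distr \<nu> borel (m g) = \<nu>" for g
    proof -
      have "m g \<circ> inv lexp = inv lexp \<circ> (+) (lexp g)"
        by (simp add: fun_eq_iff exp_law_def)
      moreover have "m g \<in> borel_measurable borel" by measurable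
      ultimately have "distr \<nu> borel (m g) = distr \<mu> borel (inv lexp \<circ> (+) (lexp g))"
        unfolding \<nu>_def by (subst distr_distr) auto
      also have "\<dots> = distr (distr \<mu> borel ((+) (lexp g))) borel (inv lexp)"
        by (subst distr_distr) auto
      finally show ?thesis by (simp add: inv \<nu>_def)
    qed
    show "emeasure \<nu> K < \<infinity>" if "compact K" for K
    proof -
      have "inv lexp -` K = lexp ` K"
        by (force intro: image_eqI[of _ _ "inv lexp _"])
      then have "emeasure \<nu> K = emeasure \<mu> (lexp ` K)"
        using that by (simp add: \<nu>_def emeasure_distr space borel_compact)
      also have "\<dots> < \<infinity>"
        using that cont_exp continuous_on_subset by (intro fin compact_continuous_image) blast
      finally show ?thesis .
    qed
  qed
  moreover have "distr \<nu> borel lexp = \<mu>"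
  proof -
    have "distr \<nu> borel lexp = distr \<mu> borel (lexp \<circ> inv lexp)"
      unfolding \<nu>_def by (subst distr_distr) auto
    also have "lexp \<circ> inv lexp = (\<lambda>x. x)" by auto
    also have "distr \<mu> borel (\<lambda>x. x) = \<mu>" by (rule distr_id2) simp
    finally show ?thesis .
  qed
  ultimately show thesis using that by metis
qed

end

section \<open>The weighted identity on the group\<close>

theorem theorem4p1:
  fixes \<A> :: "('g::{topological_group_add, t2_space, second_countable_topology},
               'm::euclidean_space) atlas"
    and L :: "'a::euclidean_space \<Rightarrow> ('g \<Rightarrow> real) \<Rightarrow> ('g \<Rightarrow> real)"
    and lexp :: "'a \<Rightarrow> 'g"
    and A :: "'a \<Rightarrow> 'a"
    and N :: "'g \<Rightarrow> real"
    and \<mu> :: "'g measure"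
    and Q \<alpha> :: real
    and f :: "'g \<Rightarrow> complex"
  assumes "homogeneous_group \<A> L lexp A"
    and "Q = lin_trace A" and "Q \<ge> 3"
    and "homogeneous_quasi_norm lexp A N"
    and "haar_measure \<mu>"
    and "f \<in> test_functions \<A>"
  shows "in_L2 \<mu> (\<lambda>x. of_real (1 / N x powr \<alpha>) * radial_deriv lexp A N f x) \<and>
    in_L2 \<mu> (\<lambda>x. f x / of_real (N x powr (\<alpha> + 1))) \<and>
    in_L2 \<mu> (\<lambda>x. of_real (1 / N x powr \<alpha>) * radial_deriv lexp A N f x
                  + of_real ((Q - 2 - 2 * \<alpha>) / (2 * N x powr (\<alpha> + 1))) * f x) \<and>
    (L2_norm \<mu> (\<lambda>x. of_real (1 / N x powr \<alpha>) * radial_deriv lexp A N f x))\<^sup>2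
      = ((Q - 2) / 2 - \<alpha>)\<^sup>2 * (L2_norm \<mu> (\<lambda>x. f x / of_real (N x powr (\<alpha> + 1))))\<^sup>2
        + (L2_norm \<mu> (\<lambda>x. of_real (1 / N x powr \<alpha>) * radial_deriv lexp A N f x
             + of_real ((Q - 2 - 2 * \<alpha>) / (2 * N x powr (\<alpha> + 1))) * f x))\<^sup>2"
proof -
  interpret hom_group \<A> L lexp A by unfold_locales (fact assms(1))
  obtain P P' :: "'a \<Rightarrow> 'a" and k where "dilations A P P' k" by (rule dilations_exist)
  then interpret D: dilations A P P' k .
  have N: "continuous_on UNIV N" "\<And>x. N x \<ge> 0" "\<And>x. N x = 0 \<longleftrightarrow> x = 0"
    "\<And>x r. r > 0 \<Longrightarrow> N (dilation lexp A r x) = r * N x"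
    using assms(4) by (auto simp: homogeneous_quasi_norm_def)
  have exp_eq_0: "lexp p = 0 \<longleftrightarrow> p = 0" for p
    using inv_exp exp_zero by metis
  interpret D: quasi_norm A P P' k "\<lambda>p. N (lexp p)"
    by unfold_locales
      (auto simp: N exp_eq_0 simp flip: dilation_exp intro!: continuous_on_compose2[OF N(1) cont_exp])
  define F where "F = f \<circ> lexp"
  have F: "smooth_on UNIV F"
    using assms(6) by (simp add: F_def test_functions_def smooth_fun_eq)
  define K where "K = inv lexp ` closure {x. f x \<noteq> 0}"
  have K: "compact K" "0 \<notin> K" "{p. F p \<noteq> 0} \<subseteq> K"
  proof -
    show "compact K"
      unfolding K_def using assms(6) cont_inv continuous_on_subset
      by (intro compact_continuous_image) (auto simp: test_functions_def)
    show "0 \<notin> K"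
    proof
      assume "0 \<in> K"
      then obtain x where x: "inv lexp x = 0" "x \<in> closure {x. f x \<noteq> 0}"
        by (auto simp: K_def)
      then have "x = 0" using exp_inv[of x] exp_zero by simp
      with x(2) assms(6) show False by (simp add: test_functions_def)
    qed
    show "{p. F p \<noteq> 0} \<subseteq> K"
    proof
      fix p assume "p \<in> {p. F p \<noteq> 0}"
      then have "lexp p \<in> closure {x. f x \<noteq> 0}"
        by (intro subsetD[OF closure_subset]) (simp add: F_def)
      then have "inv lexp (lexp p) \<in> K" unfolding K_def by (rule imageI)
      then show "p \<in> K" by simp
    qed
  qed
  define c where "c = (Q - 2) / 2 - \<alpha>"
  define U where "U p = of_real (N (lexp p) powr (- \<alpha> - 1)) * frechet_derivative F (at p) (A p)" for p
  define V where "V p = of_real (N (lexp p) powr (- \<alpha> - 1)) * F p" for p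
  have radial: "of_real (1 / N x powr \<alpha>) * radial_deriv lexp A N f x = U (inv lexp x)" for x
  proof (cases "x = 0")
    \<comment> \<open>At the identity both weights are \<open>0\<close>, since
      \<open>0 powr a = 0\<close> and division by zero gives \<open>0\<close>.\<close>
    case True
    moreover have "N 0 = 0" using N(3) by blast
    ultimately show ?thesis by (simp add: U_def)
  next
    case False
    define p where "p = inv lexp x"
    have x: "x = lexp p" by (simp add: p_def)
    define n where "n = N x"
    have n: "n > 0" using False N(2)[of x] N(3)[of x] by (simp add: n_def less_le)
    \<comment> \<open>This is the point of the unit quasi-sphere on the dilation orbit of
      \<open>p\<close>; its orbit passes through \<open>p\<close> at parameter
      \<open>n\<close>.\<close>
    define q where "q = alg_dilation A (1 / n) p"
    have p: "alg_dilation A n q = p" using n by (simp add: q_def D.delta_delta D.delta_one)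
    have F': "(F has_derivative frechet_derivative F (at p)) (at p)"
      by (rule smooth_on_has_derivative[OF F]) simp
    have "(F \<circ> (\<lambda>r. alg_dilation A r q) has_derivative
        frechet_derivative F (at p) \<circ> (\<lambda>h. h *\<^sub>R (1 / n) *\<^sub>R A p)) (at n)"
      using D.has_vector_derivative_delta[OF n, of q] F'
      by (intro diff_chain_at) (simp_all add: p has_vector_derivative_def)
    moreover have "frechet_derivative F (at p) \<circ> (\<lambda>h. h *\<^sub>R (1 / n) *\<^sub>R A p)
        = (\<lambda>h. h *\<^sub>R (1 / n) *\<^sub>R frechet_derivative F (at p) (A p))"
      by (simp add: fun_eq_iff linear_cmul[OF has_derivative_linear[OF F']])
    ultimately have "((F \<circ> (\<lambda>r. alg_dilation A r q)) has_vector_derivative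
        (1 / n) *\<^sub>R frechet_derivative F (at p) (A p)) (at n)"
      by (simp only: has_vector_derivative_def)
    moreover have "(\<lambda>r. f (dilation lexp A r (dilation lexp A (1 / N x) x))) = F \<circ> (\<lambda>r. alg_dilation A r q)"
      by (simp add: x dilation_exp F_def fun_eq_iff q_def n_def)
    ultimately have "radial_deriv lexp A N f x = (1 / n) *\<^sub>R frechet_derivative F (at p) (A p)"
      by (simp only: radial_deriv_def n_def[symmetric] vector_derivative_at)
    moreover have "1 / n powr \<alpha> * (1 / n) = n powr (- \<alpha> - 1)"
      using n by (simp add: powr_diff powr_minus field_simps)
    moreover have "of_real (1 / n powr \<alpha>) * ((1 / n) *\<^sub>R Z) = of_real (1 / n powr \<alpha> * (1 / n)) * Z"
      for Z :: complex
      by (simp add: scaleR_conv_of_real)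
    ultimately show ?thesis
      by (simp only: U_def p_def[symmetric] x[symmetric] n_def[symmetric])
  qed
  \<comment> \<open>This holds at the identity as well, where both sides are \<open>0\<close> by the
    same conventions.\<close>
  have weighted: "f x / of_real (N x powr (\<alpha> + 1)) = V (inv lexp x)" for x
  proof -
    have "N x powr (- \<alpha> - 1) = inverse (N x powr (\<alpha> + 1))"
      using powr_minus[of "N x" "\<alpha> + 1"] by simp
    then show ?thesis by (simp add: V_def F_def divide_inverse)
  qed
  have "of_real ((Q - 2 - 2 * \<alpha>) / (2 * N x powr (\<alpha> + 1))) * f x = c *\<^sub>R (f x / of_real (N x powr (\<alpha> + 1)))" for x
    by (simp add: c_def scaleR_conv_of_real field_simps)
  then have total: "of_real (1 / N x powr \<alpha>) * radial_deriv lexp A N f x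
      + of_real ((Q - 2 - 2 * \<alpha>) / (2 * N x powr (\<alpha> + 1))) * f x
      = U (inv lexp x) + c *\<^sub>R V (inv lexp x)" for x
    by (simp only: radial weighted)

  obtain \<kappa> where \<kappa>: "\<kappa> \<ge> 0" "\<mu> = distr (density lborel (\<lambda>_. ennreal \<kappa>)) borel lexp"
    using haar_measure_pullback[OF assms(5)] .
  have [measurable]: "lexp \<in> borel_measurable borel" "inv lexp \<in> borel_measurable borel"
    by (intro borel_measurable_continuous_onI cont_exp cont_inv)+
  \<comment> \<open>Every squared norm on the group is \<kappa> times a Lebesgue integral, with the
    same factor on both sides of the identity.\<close>
  have L2: "in_L2 \<mu> (\<lambda>x. W (inv lexp x))"
    "(L2_norm \<mu> (\<lambda>x. W (inv lexp x)))\<^sup>2 = \<kappa> * (\<integral>p. (cmod (W p))\<^sup>2 \<partial>lborel)"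
    if [measurable]: "W \<in> borel_measurable borel" and int: "integrable lborel (\<lambda>p. (cmod (W p))\<^sup>2)"
    for W :: "'a \<Rightarrow> complex"
  proof -
    have "integrable \<mu> (\<lambda>x. (cmod (W (inv lexp x)))\<^sup>2)"
      unfolding \<kappa>(2) using \<kappa>(1) int
      by (subst integrable_distr_eq) (auto simp: integrable_density)
    then show "in_L2 \<mu> (\<lambda>x. W (inv lexp x))"
      by (simp add: in_L2_def \<kappa>(2))
    have "(\<integral>x. (cmod (W (inv lexp x)))\<^sup>2 \<partial>\<mu>) = \<kappa> * (\<integral>p. (cmod (W p))\<^sup>2 \<partial>lborel)"
      unfolding \<kappa>(2) using \<kappa>(1) by (subst integral_distr) (auto simp: integral_density)
    then show "(L2_norm \<mu> (\<lambda>x. W (inv lexp x)))\<^sup>2 = \<kappa> * (\<integral>p. (cmod (W p))\<^sup>2 \<partial>lborel)"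
      using \<kappa>(1) by (simp add: L2_norm_def)
  qed
  have c: "c = (lin_trace A - 2) / 2 - \<alpha>" by (simp add: c_def assms(2))
  note identity = D.hardy_identity[where f = F, OF F K c, folded U_def V_def]
  have [measurable]: "U \<in> borel_measurable borel" "V \<in> borel_measurable borel"
    using identity(1,2) .
  have "(\<lambda>p. U p + c *\<^sub>R V p) \<in> borel_measurable borel" by measurable
  note L2_UV = L2[OF this identity(5)]
  show ?thesis
    \<comment> \<open>The sum has to be rewritten first, because \<open>radial\<close> would already
      change its first summand.\<close>
    unfolding total unfolding radial weighted
    using L2[OF identity(1,3)] L2[OF identity(2,4)] L2_UV identity(6)
    by (simp add: c_def[symmetric] algebra_simps)
qed

end
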